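(* Let $X$ be a triangulation of a closed $D$-manifold. Then the barycentric subdivision $\mathrm{sd}(X)$ is a $D$-colex, with the sets $\mathcal B_{b(\delta),\,\mathrm{sd}(\partial\delta)}$, $\delta\in\Delta_D(X)$, as its colorable $D$-balls, and with the coloring of $\mathrm{sd}(X)$ given by assigning to each vertex $b(\sigma)$ (for $\sigma\in\Delta_i(X)$, $0\le i\le D$) the color $i$.
   Context: A triangulation of a closed $D$-manifold is a finite $D$-dimensional simplicial complex homeomorphic to it; $\Delta_i(X)$ denotes the set of $i$-simplices. $\sigma\star\tau$ denotes the join of simplices with disjoint vertex sets (the simplex spanned by the union of the vertex sets). A proper $(D+1)$-coloring is a map from vertices to $\{0,\dots,D\}$ giving the endpoints of each edge different colors. Barycentric subdivision: for a simplex $\sigma$ with vertices $v_0,\dots,v_i$, $b(\sigma)=\frac1{i+1}\sum_j v_j$ is its barycenter. Recursively, $\mathrm{sd}(\Delta^0)=\Delta^0$, and for $i\ge 1$, $\mathrm{sd}(\partial\sigma)$ is obtained by subdividing each $(i-1)$-face of $\sigma$ and gluing along shared faces, and $\mathrm{sd}(\sigma)=b(\sigma)\star\mathrm{sd}(\partial\sigma)$. For a simplicial complex, $\mathrm{sd}(X)=\bigcup_{\delta\in\Delta_D(X)}\mathrm{sd}(\delta)$, glued along shared faces. Colex (recursive definition): a colorable $0$-ball is a single vertex, and a $0$-colex is a finite collection of colorable $0$-balls. For $D\ge 1$, a colorable $D$-ball is the simplicial complex with set of $D$-simplices $$\mathcal B_{v,Y}=\{v\star\tau\mid\tau\in\Delta_{D-1}(Y)\},$$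 where $Y$ is a $(D-1)$-colex homeomorphic to the sphere $S^{D-1}$ and $v$ is a vertex not in $Y$; its boundary is $\partial\mathcal B_{v,Y}=Y$. A $D$-colex is a simplicial complex that is a union of colorable $D$-balls $\mathcal B_{v,Y}$, no two sharing a $D$-simplex, glued together along their boundaries so that every $(D-1)$-simplex in the boundary of a ball belongs to the boundary of exactly two distinct colorable $D$-balls, and whose vertices admit a proper $(D+1)$-coloring. *)

theory Defs
  imports "HOL-Analysis.Analysis"
begin

section \<open>Closed manifolds\<close>

definition second_countable_space :: "'b topology \<Rightarrow> bool" where
  "second_countable_space M \<longleftrightarrow>
     (\<exists>\<B>. countable \<B> \<and> (\<forall>U\<in>\<B>. openin M U) \<and>
          (\<forall>U x. openin M U \<and> x \<in> U \<longrightarrow> (\<exists>V\<in>\<B>. x \<in> V \<and> V \<subseteq> U)))"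

definition locally_Euclidean_space :: "nat \<Rightarrow> 'b topology \<Rightarrow> bool" where
  "locally_Euclidean_space D M \<longleftrightarrow>
     (\<forall>x\<in>topspace M. \<exists>U V. openin M U \<and> x \<in> U \<and> openin (Euclidean_space D) V \<and>
        subtopology M U homeomorphic_space subtopology (Euclidean_space D) V)"

text \<open>Closed means compact and without boundary; connectedness is not required.\<close>

definition closed_manifold :: "nat \<Rightarrow> 'b topology \<Rightarrow> bool" where
  "closed_manifold D M \<longleftrightarrow>
     Hausdorff_space M \<and> second_countable_space M \<and> compact_space M \<and> locally_Euclidean_space D M"


section \<open>Geometric simplicial complexes\<close>

text \<open>
  Complexes are the finite geometric ones of \<^const>\<open>simplicial_complex\<close>, in an arbitrary Euclidean
  space. There the empty set is a simplex of dimension \<open>-1\<close> and belongs to every complex having some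
  simplex at all, which is why the dimension of a simplex is an integer. The complex without
  vertices that bounds a single point is \<open>{{}}\<close>.
\<close>

definition simplices :: "int \<Rightarrow> 'a::euclidean_space set set \<Rightarrow> 'a set set" where
  "simplices i K = {\<sigma> \<in> K. i simplex \<sigma>}"

definition verts :: "'a::euclidean_space set \<Rightarrow> 'a set" where
  "verts \<sigma> = {v. v extreme_point_of \<sigma>}"

definition complex_vertices :: "'a::euclidean_space set set \<Rightarrow> 'a set" where
  "complex_vertices K = {v. {v} \<in> K}"

definition dimensional_complex :: "nat \<Rightarrow> 'a::euclidean_space set set \<Rightarrow> bool" where
  "dimensional_complex D K \<longleftrightarrow>
     simplicial_complex K \<and> simplices (int D) K \<noteq> {} \<and> (\<forall>\<sigma>\<in>K. aff_dim \<sigma> \<le> int D)"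

definition triangulates :: "nat \<Rightarrow> 'a::euclidean_space set set \<Rightarrow> 'b topology \<Rightarrow> bool" where
  "triangulates D K M \<longleftrightarrow>
     dimensional_complex D K \<and> top_of_set (\<Union>K) homeomorphic_space M"

definition simplex_join :: "'a::euclidean_space set \<Rightarrow> 'a set \<Rightarrow> 'a set" where
  "simplex_join \<sigma> \<tau> = convex hull (verts \<sigma> \<union> verts \<tau>)"

definition generated_complex :: "'a::euclidean_space set set \<Rightarrow> 'a set set" where
  "generated_complex S = {\<rho>. \<exists>\<sigma>\<in>S. \<rho> face_of \<sigma>}"

definition proper_coloring :: "nat \<Rightarrow> 'a::euclidean_space set set \<Rightarrow> ('a \<Rightarrow> nat) \<Rightarrow> bool" where
  "proper_coloring D K c \<longleftrightarrow>
     c ` complex_vertices K \<subseteq> {0..D} \<and>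
     (\<forall>e\<in>simplices 1 K. \<forall>u\<in>verts e. \<forall>w\<in>verts e. u \<noteq> w \<longrightarrow> c u \<noteq> c w)"


section \<open>Barycentric subdivision\<close>

definition barycenter :: "'a::euclidean_space set \<Rightarrow> 'a" where
  "barycenter \<sigma> = (1 / real (card (verts \<sigma>))) *\<^sub>R (\<Sum>v\<in>verts \<sigma>. v)"

text \<open>Since \<open>{} \<in> L\<close> for a complex \<open>L\<close>, the apex \<open>{b}\<close> itself is one of the joins below.\<close>

definition cone_complex :: "'a::euclidean_space \<Rightarrow> 'a set set \<Rightarrow> 'a set set" where
  "cone_complex b L = L \<union> {simplex_join {b} \<tau> | \<tau>. \<tau> \<in> L}"

text \<open>The first argument is the dimension of the simplex.\<close>

fun sd_simplex :: "nat \<Rightarrow> 'a::euclidean_space set \<Rightarrow> 'a set set"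
  and sd_boundary :: "nat \<Rightarrow> 'a set \<Rightarrow> 'a set set" where
  "sd_simplex 0 \<sigma> = {\<rho>. \<rho> face_of \<sigma>}"
| "sd_simplex (Suc i) \<sigma> = cone_complex (barycenter \<sigma>) (sd_boundary (Suc i) \<sigma>)"
| "sd_boundary 0 \<sigma> = {{}}"
| "sd_boundary (Suc i) \<sigma> = (\<Union>\<tau>\<in>{\<tau>. \<tau> facet_of \<sigma>}. sd_simplex i \<tau>)"

definition barycentric_subdivision ::
    "nat \<Rightarrow> 'a::euclidean_space set set \<Rightarrow> 'a set set" where
  "barycentric_subdivision D K = (\<Union>\<delta>\<in>simplices (int D) K. sd_simplex D \<delta>)"


section \<open>Colexes\<close>

text \<open>
  The ball \<open>\<B>\<^bsub>v,Y\<^esub>\<close> is encoded by the pair \<open>(v, Y)\<close> of its centre and its boundary.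
  For \<open>D = 0\<close> it is the single vertex \<open>v\<close>, with \<open>Y = {{}}\<close>.
\<close>

definition ball_simplices ::
    "nat \<Rightarrow> 'a::euclidean_space \<Rightarrow> 'a set set \<Rightarrow> 'a set set" where
  "ball_simplices D v Y = {simplex_join {v} \<tau> | \<tau>. \<tau> \<in> simplices (int D - 1) Y}"

definition ball_complex ::
    "nat \<Rightarrow> 'a::euclidean_space \<Rightarrow> 'a set set \<Rightarrow> 'a set set" where
  "ball_complex D v Y = generated_complex (ball_simplices D v Y)"

text \<open>
  In a colorable ball of positive dimension, the last two conjuncts say that \<open>v\<close> is in general
  position with respect to \<open>Y\<close>, so that the geometric joins form a realization of the abstract
  cone. \<open>colex D K P c\<close> states that \<open>K\<close> is a \<open>D\<close>-colex with set of balls \<open>P\<close> and coloring \<open>c\<close>.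
  Distinct elements of \<open>P\<close> encode distinct balls, as their sets of \<open>D\<close>-simplices are nonempty and
  required to be disjoint.
\<close>

fun colorable_ball :: "nat \<Rightarrow> 'a::euclidean_space \<Rightarrow> 'a set set \<Rightarrow> bool"
  and colex :: "nat \<Rightarrow> 'a set set \<Rightarrow> ('a \<times> 'a set set) set \<Rightarrow> ('a \<Rightarrow> nat) \<Rightarrow> bool" where
  "colorable_ball 0 v Y \<longleftrightarrow> Y = {{}}"
| "colorable_ball (Suc D) v Y \<longleftrightarrow>
     (\<exists>P c. colex D Y P c) \<and>
     top_of_set (\<Union>Y) homeomorphic_space nsphere D \<and>
     v \<notin> complex_vertices Y \<and>
     (\<forall>\<sigma>\<in>ball_simplices (Suc D) v Y. int (Suc D) simplex \<sigma>) \<and>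
     simplicial_complex (ball_complex (Suc D) v Y)"
| "colex D K P c \<longleftrightarrow>
     simplicial_complex K \<and> finite P \<and>
     (\<forall>(v, Y)\<in>P. colorable_ball D v Y) \<and>
     K = (\<Union>(v, Y)\<in>P. ball_complex D v Y) \<and>
     (\<forall>(v, Y)\<in>P. \<forall>(w, Z)\<in>P. (v, Y) \<noteq> (w, Z) \<longrightarrow>
        ball_simplices D v Y \<inter> ball_simplices D w Z = {} \<and>
        ball_complex D v Y \<inter> ball_complex D w Z \<subseteq> Y \<inter> Z) \<and>
     (D \<ge> 1 \<longrightarrow> (\<forall>(v, Y)\<in>P. \<forall>\<tau>\<in>simplices (int D - 1) Y. card {(w, Z) \<in> P. \<tau> \<in> Z} = 2)) \<and>
     proper_coloring D K c"

end

theory Submission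
  imports Defs "HOL-Homology.Invariance_of_Domain"
begin

text \<open>
  A simplex of \<open>sd X\<close> is the convex hull of the barycenters of a flag, that is, a chain of nonempty
  simplices of \<open>X\<close>. A point determines its flag and its coordinates there: the largest member is
  the simplex with the point in its relative interior, and the ray from the barycenter of that member
  through the point meets the relative frontier in a point of a shorter flag. Hence \<open>sd X\<close> is a
  simplicial complex, coloured properly by dimension.

  For the colex axioms \<open>X\<close> only has to be pure and to have every \<open>(D - 1)\<close>-simplex in exactly two
  \<open>D\<close>-simplices. The boundary of a simplex has these properties again, so the recursion in the
  definition of a colex is an induction on \<open>D\<close>. For a triangulated manifold both properties follow
  from invariance of domain at an interior point \<open>x\<close> of a maximal simplex or of a
  \<open>(D - 1)\<close>-simplex \<open>F\<close>. If only one \<open>D\<close>-simplex contained \<open>F\<close>, it would be a neighbourhood of its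
  boundary point \<open>x\<close> in its affine hull; if three did, two of them would already form a neighbourhood
  of \<open>x\<close> in the manifold, which the third one meets outside their union.
\<close>


section \<open>Faces, barycenters and simplicial complexes\<close>

lemma simplicial_complex_face:
  assumes "simplicial_complex K" "\<sigma> \<in> K" "\<tau> \<in> K" "\<sigma> \<subseteq> \<tau>"
  shows "\<sigma> face_of \<tau>"
  using assms unfolding simplicial_complex_def by (metis inf.absorb2)

lemma simplicial_complex_subset:
  assumes "simplicial_complex K" "L \<subseteq> K" "\<And>\<sigma> \<tau>. \<sigma> \<in> L \<Longrightarrow> \<tau> face_of \<sigma> \<Longrightarrow> \<tau> \<in> L"
  shows "simplicial_complex L"
  using assms unfolding simplicial_complex_def by (meson finite_subset subsetD)

lemma simplex_face_obtain:
  assumes "n simplex \<sigma>" "\<tau> face_of \<sigma>"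
  obtains m where "m simplex \<tau>"
proof -
  obtain V where V: "\<not> affine_dependent V" "\<sigma> = convex hull V"
    using assms(1) by (auto simp: simplex_def)
  then obtain W where W: "W \<subseteq> V" "\<tau> = convex hull W"
    using assms(2) face_of_convex_hull_affine_independent by metis
  moreover have "\<not> affine_dependent W"
    using V W affine_independent_subset by blast
  ultimately have "int (card W) - 1 simplex \<tau>"
    unfolding simplex_def by auto
  then show thesis by (rule that)
qed

lemma simplicial_complex_faces:
  assumes "n simplex \<sigma>"
  shows "simplicial_complex {\<tau>. \<tau> face_of \<sigma>}"
  unfolding simplicial_complex_def
proof (intro conjI allI impI ballI)
  show "finite {\<tau>. \<tau> face_of \<sigma>}"
    using assms finite_polytope_faces simplex_imp_polytope by blast
  fix S assume "S \<in> {\<tau>. \<tau> face_of \<sigma>}"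
  then show "\<exists>n. n simplex S" using assms simplex_face_obtain by blast
next
  fix F S assume "S \<in> {\<tau>. \<tau> face_of \<sigma>} \<and> F face_of S"
  then show "F \<in> {\<tau>. \<tau> face_of \<sigma>}" using face_of_trans by auto
next
  fix S S' assume "S \<in> {\<tau>. \<tau> face_of \<sigma>} \<and> S' \<in> {\<tau>. \<tau> face_of \<sigma>}"
  then show "S \<inter> S' face_of S"
    by (metis face_of_Int face_of_imp_subset face_of_subset inf_le1 mem_Collect_eq)
qed

text \<open>The boundary complex of a simplex. The empty face belongs to it as soon as
  \<open>\<sigma>\<close> is nonempty, so for a single point it is \<open>{{}}\<close>.\<close>

definition proper_faces :: "'a::euclidean_space set \<Rightarrow> 'a set set" where
  "proper_faces \<sigma> = {\<tau>. \<tau> face_of \<sigma> \<and> \<tau> \<noteq> \<sigma>}"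

lemma simplicial_complex_proper_faces:
  assumes "n simplex \<sigma>"
  shows "simplicial_complex (proper_faces \<sigma>)"
proof (rule simplicial_complex_subset[OF simplicial_complex_faces[OF assms]])
  fix \<tau> \<rho> assume "\<tau> \<in> proper_faces \<sigma>" "\<rho> face_of \<tau>"
  then show "\<rho> \<in> proper_faces \<sigma>"
    unfolding proper_faces_def
    by (metis (mono_tags, lifting) face_of_imp_subset face_of_trans mem_Collect_eq subset_antisym)
qed (auto simp: proper_faces_def)

lemma simplex_aff_dim_face_less:
  assumes "n simplex \<sigma>" "\<tau> face_of \<sigma>" "\<tau> \<noteq> \<sigma>"
  shows "aff_dim \<tau> < n"
  using assms aff_dim_simplex convex_simplex face_of_aff_dim_lt by metis

text \<open>The relative interior consists of the convex combinations of the vertices with all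
  coefficients positive; here each coefficient is \<open>1 / card V\<close>.\<close>

lemma barycenter_in_rel_interior:
  assumes "n simplex \<sigma>" "\<sigma> \<noteq> {}"
  shows "barycenter \<sigma> \<in> rel_interior \<sigma>"
proof -
  obtain V where V: "finite V" "\<not> affine_dependent V" "\<sigma> = convex hull V"
    using assms(1) by (auto simp: simplex)
  have v: "verts \<sigma> = V"
    unfolding verts_def using V extreme_point_of_convex_hull_affine_independent by blast
  have "V \<noteq> {}" using V assms by auto
  then have c: "card V > 0" using V by (simp add: card_gt_0_iff)
  show ?thesis
    unfolding V(3) rel_interior_convex_hull_explicit[OF V(2)]
    unfolding V(3)[symmetric] barycenter_def v
    using c by (auto simp: scaleR_sum_right intro!: exI[of _ "\<lambda>x. 1 / real (card V)"])
qed

text \<open>The intersection is a face of \<open>\<sigma>\<close>, and a face that reaches the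
  relative interior is all of \<open>\<sigma>\<close>.\<close>

lemma rel_interior_meets_simplex:
  assumes "simplicial_complex K" "\<sigma> \<in> K" "\<tau> \<in> K" "x \<in> rel_interior \<sigma>" "x \<in> \<tau>"
  shows "\<sigma> \<subseteq> \<tau>"
proof -
  have "\<sigma> \<inter> \<tau> face_of \<sigma>" using assms unfolding simplicial_complex_def by blast
  moreover have "\<sigma> \<inter> \<tau> \<inter> rel_interior \<sigma> \<noteq> {}"
    using assms rel_interior_subset by blast
  ultimately show ?thesis using face_of_disjoint_rel_interior by (metis inf_le2)
qed

text \<open>Each barycenter lies in the relative interior of its simplex, and distinct simplices
  have disjoint relative interiors. The empty simplex is excluded because division by zero places
  its barycenter at the origin, possibly on top of another one.\<close>

lemma barycenter_inj:
  assumes "simplicial_complex K"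
  shows "inj_on barycenter (K - {{}})"
proof (rule inj_onI)
  have b: "barycenter \<sigma> \<in> rel_interior \<sigma>" if "\<sigma> \<in> K - {{}}" for \<sigma>
    using that assms barycenter_in_rel_interior unfolding simplicial_complex_def by blast
  fix \<sigma> \<tau> assume st: "\<sigma> \<in> K - {{}}" "\<tau> \<in> K - {{}}" "barycenter \<sigma> = barycenter \<tau>"
  have "\<sigma> \<subseteq> \<tau>" "\<tau> \<subseteq> \<sigma>"
    using rel_interior_meets_simplex[OF assms] st b rel_interior_subset by (metis DiffD1 subsetD)+
  then show "\<sigma> = \<tau>" by simp
qed

section \<open>Flags of simplices\<close>

text \<open>A flag may skip dimensions and may be empty. The empty flag stands for the empty simplex
  of the subdivision.\<close>

definition flags :: "'a::euclidean_space set set \<Rightarrow> 'a set set set" where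
  "flags K = {C. C \<subseteq> K - {{}} \<and> chain_subset C}"

definition flag_simplex :: "'a::euclidean_space set set \<Rightarrow> 'a set" where
  "flag_simplex C = convex hull (barycenter ` C)"

lemma flag_simplex_empty [simp]: "flag_simplex {} = {}"
  by (simp add: flag_simplex_def)

lemma flags_subset: "C \<in> flags K \<Longrightarrow> B \<subseteq> C \<Longrightarrow> B \<in> flags K"
  unfolding flags_def chain_subset_def by blast

lemma flags_mono: "C \<in> flags K \<Longrightarrow> C \<subseteq> L \<Longrightarrow> C \<in> flags L"
  unfolding flags_def by blast

lemma flags_empty [simp]: "{} \<in> flags K"
  by (simp add: flags_def chain_subset_def)

lemma flags_finite: "simplicial_complex K \<Longrightarrow> C \<in> flags K \<Longrightarrow> finite C"
  unfolding flags_def simplicial_complex_def by (metis (mono_tags, lifting) finite_Diff finite_subset mem_Collect_eq)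

lemma flags_insert_top:
  assumes "B \<in> flags K" "\<sigma> \<in> K" "\<sigma> \<noteq> {}" "\<And>\<tau>. \<tau> \<in> B \<Longrightarrow> \<tau> \<subseteq> \<sigma>"
  shows "insert \<sigma> B \<in> flags K"
  using assms unfolding flags_def chain_subset_def by blast

text \<open>A finite chain has a largest member, and the other members, being simplices of the
  complex inside it, are proper faces of it. This splitting drives the inductions over flags
  below.\<close>

lemma flag_top:
  assumes "simplicial_complex K" "C \<in> flags K" "C \<noteq> {}"
  obtains \<sigma> where "\<sigma> \<in> C" "\<sigma> \<in> K" "\<sigma> \<noteq> {}" "C - {\<sigma>} \<in> flags (proper_faces \<sigma>)"
    "barycenter \<sigma> \<in> rel_interior \<sigma>"
proof -
  have fin: "finite C" using flags_finite assms by blast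
  obtain \<sigma> where s: "\<sigma> \<in> C" "\<And>\<tau>. \<tau> \<in> C \<Longrightarrow> \<sigma> \<subseteq> \<tau> \<Longrightarrow> \<sigma> = \<tau>"
    using finite_has_maximal[OF fin assms(3)] by metis
  have sK: "\<sigma> \<in> K" "\<sigma> \<noteq> {}" using s assms by (auto simp: flags_def)
  have "\<tau> \<subseteq> \<sigma>" if "\<tau> \<in> C" for \<tau>
    using s that assms(2) unfolding flags_def chain_subset_def by blast
  then have "C - {\<sigma>} \<subseteq> proper_faces \<sigma>"
    using assms simplicial_complex_face[OF assms(1) _ sK(1)]
    by (auto simp: proper_faces_def flags_def)
  then have "C - {\<sigma>} \<in> flags (proper_faces \<sigma>)"
    using assms(2) flags_mono flags_subset by (metis Diff_subset)
  moreover have "barycenter \<sigma> \<in> rel_interior \<sigma>"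
    using sK assms(1) barycenter_in_rel_interior unfolding simplicial_complex_def by blast
  ultimately show thesis using that s sK by blast
qed

text \<open>All barycenters of the flag lie in its top member, a proper face of
  \<open>\<sigma>\<close>. Such a face lies in the relative frontier, and even its affine hull
  misses the relative interior.\<close>

lemma flags_proper_faces_hull:
  assumes K: "simplicial_complex K" "\<sigma> \<in> K" and B: "B \<in> flags (proper_faces \<sigma>)"
  shows "flag_simplex B \<subseteq> rel_frontier \<sigma>" "barycenter \<sigma> \<in> rel_interior \<sigma> \<Longrightarrow> barycenter \<sigma> \<notin> affine hull (barycenter ` B)"
proof -
  obtain n where n: "n simplex \<sigma>" using K unfolding simplicial_complex_def by blast
  have sc: "simplicial_complex (proper_faces \<sigma>)" using simplicial_complex_proper_faces n by blast
  show "flag_simplex B \<subseteq> rel_frontier \<sigma>"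
    and "barycenter \<sigma> \<in> rel_interior \<sigma> \<Longrightarrow> barycenter \<sigma> \<notin> affine hull (barycenter ` B)"
  proof (atomize (full), cases "B = {}")
    case True then show "flag_simplex B \<subseteq> rel_frontier \<sigma> \<and>
       (barycenter \<sigma> \<in> rel_interior \<sigma> \<longrightarrow> barycenter \<sigma> \<notin> affine hull barycenter ` B)" by simp
  next
    case False
    obtain \<tau> where t: "\<tau> \<in> B" "\<tau> \<in> proper_faces \<sigma>" "B - {\<tau>} \<in> flags (proper_faces \<tau>)"
      using flag_top[OF sc B False] by metis
    have f: "\<tau> face_of \<sigma>" "\<tau> \<noteq> \<sigma>" using t by (auto simp: proper_faces_def)
    have "barycenter \<rho> \<in> \<tau>" if "\<rho> \<in> B" for \<rho>
    proof -
      have "\<rho> \<in> proper_faces \<sigma>" "\<rho> \<noteq> {}" using that B by (auto simp: flags_def)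
      then have "barycenter \<rho> \<in> rel_interior \<rho>"
        using sc barycenter_in_rel_interior unfolding simplicial_complex_def by blast
      moreover have "\<rho> \<subseteq> \<tau>" using t that face_of_imp_subset by (auto simp: flags_def proper_faces_def)
      ultimately show ?thesis using rel_interior_subset by blast
    qed
    then have sub: "barycenter ` B \<subseteq> \<tau>" by blast
    then have "flag_simplex B \<subseteq> \<tau>"
      unfolding flag_simplex_def using face_of_imp_convex[OF f(1)] by (rule hull_minimal)
    moreover have "\<tau> \<subseteq> rel_frontier \<sigma>" using f face_of_subset_rel_frontier by blast
    moreover have "affine hull (barycenter ` B) \<subseteq> affine hull \<tau>" using sub hull_mono by blast
    moreover have "affine hull \<tau> \<inter> rel_interior \<sigma> = {}"
      using affine_hull_face_of_disjoint_rel_interior f n convex_simplex by blast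
    ultimately show "flag_simplex B \<subseteq> rel_frontier \<sigma> \<and>
       (barycenter \<sigma> \<in> rel_interior \<sigma> \<longrightarrow> barycenter \<sigma> \<notin> affine hull barycenter ` B)" by blast
  qed
qed

text \<open>Remove the top member: its barycenter is off the affine hull of the remaining
  barycenters, so putting it back preserves independence.\<close>

lemma flag_affine_independent:
  assumes "simplicial_complex K" "C \<in> flags K"
  shows "\<not> affine_dependent (barycenter ` C)"
  using assms
proof (induction "card C" arbitrary: C K rule: less_induct)
  case less
  show ?case
  proof (cases "C = {}")
    case False
    obtain \<sigma> where s: "\<sigma> \<in> C" "\<sigma> \<in> K" "C - {\<sigma>} \<in> flags (proper_faces \<sigma>)" "barycenter \<sigma> \<in> rel_interior \<sigma>"
      using flag_top[OF less.prems False] by metis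
    have "\<not> affine_dependent (barycenter ` (C - {\<sigma>}))"
      using less.hyps[OF _ less.prems(1)] less.prems s flags_finite flags_subset
      by (metis Diff_subset card_Diff1_less)
    then have "\<not> affine_dependent (insert (barycenter \<sigma>) (barycenter ` (C - {\<sigma>})))"
      using flags_proper_faces_hull[OF less.prems(1) s(2,3)] s(4) affine_independent_insert by blast
    then show ?thesis using s(1) by (metis image_insert insert_Diff)
  qed auto
qed

lemma flag_simplex_insert_top:
  "C - {\<sigma>} = B \<Longrightarrow> \<sigma> \<in> C \<Longrightarrow> flag_simplex C = convex hull (insert (barycenter \<sigma>) (flag_simplex B))"
  unfolding flag_simplex_def by (metis hull_insert hull_hull image_insert insert_Diff)

text \<open>The simplex of \<open>C\<close> is a cone with apex in the relative interior of the top
  \<open>\<sigma>\<close> and base in its relative frontier. A segment from the apex to the base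
  stays in the relative interior up to its last point, so only points of the base can lie
  outside.\<close>

lemma flag_simplex_rel_interior_top:
  assumes K: "simplicial_complex K" "C \<in> flags K" and s: "\<sigma> \<in> C" "C - {\<sigma>} \<in> flags (proper_faces \<sigma>)"
  shows "flag_simplex C \<subseteq> \<sigma>" "flag_simplex C - rel_interior \<sigma> \<subseteq> flag_simplex (C - {\<sigma>})"
proof -
  have sK: "\<sigma> \<in> K" "\<sigma> \<noteq> {}" using s K by (auto simp: flags_def)
  obtain n where n: "n simplex \<sigma>" using K sK unfolding simplicial_complex_def by blast
  have b: "barycenter \<sigma> \<in> rel_interior \<sigma>" using n sK barycenter_in_rel_interior by blast
  have f: "flag_simplex (C - {\<sigma>}) \<subseteq> rel_frontier \<sigma>"
    using flags_proper_faces_hull K sK s by blast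
  have sub: "rel_frontier \<sigma> \<subseteq> \<sigma>"
    by (simp add: closed_simplex[OF n] rel_frontier_def Diff_subset)
  have eq: "flag_simplex C = convex hull (insert (barycenter \<sigma>) (flag_simplex (C - {\<sigma>})))"
    using flag_simplex_insert_top s by blast
  show "flag_simplex C \<subseteq> \<sigma>"
    unfolding eq using b f sub rel_interior_subset convex_simplex[OF n] by (intro hull_minimal) auto
  show "flag_simplex C - rel_interior \<sigma> \<subseteq> flag_simplex (C - {\<sigma>})"
  proof
    fix x assume x: "x \<in> flag_simplex C - rel_interior \<sigma>"
    show "x \<in> flag_simplex (C - {\<sigma>})"
    proof (cases "flag_simplex (C - {\<sigma>}) = {}")
      case True then show ?thesis using x b by (auto simp: eq)
    next
      case False
      have "convex (flag_simplex (C - {\<sigma>}))" by (simp add: flag_simplex_def)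
      then obtain y where y: "y \<in> flag_simplex (C - {\<sigma>})" "x \<in> closed_segment (barycenter \<sigma>) y"
        using x False unfolding eq by (auto simp: convex_hull_insert_segments hull_same split: if_splits)
      have "y \<in> closure \<sigma>" using y f sub closure_subset by blast
      then have "open_segment (barycenter \<sigma>) y \<subseteq> rel_interior \<sigma>"
        using rel_interior_closure_convex_segment convex_simplex[OF n] b by blast
      then have "x = y" using x y b by (auto simp: closed_segment_eq_open)
      then show ?thesis using y by simp
    qed
  qed
qed

lemma flag_simplex_Int:
  assumes "simplicial_complex K" "B \<in> flags K" "C \<in> flags K"
  shows "flag_simplex B \<inter> flag_simplex C = flag_simplex (B \<inter> C)"
proof
  show "flag_simplex (B \<inter> C) \<subseteq> flag_simplex B \<inter> flag_simplex C"
    unfolding flag_simplex_def by (simp add: hull_mono image_mono)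
  show "flag_simplex B \<inter> flag_simplex C \<subseteq> flag_simplex (B \<inter> C)"
    using assms
  proof (induction "card B + card C" arbitrary: B C rule: less_induct)
    case less
    note K = assms(1)
    show ?case
    proof (cases "B = {} \<or> C = {}")
      case False
      have fin: "finite B" "finite C" using less.prems flags_finite by blast+
      obtain \<sigma> where s: "\<sigma> \<in> B" "\<sigma> \<in> K" "B - {\<sigma>} \<in> flags (proper_faces \<sigma>)" "barycenter \<sigma> \<in> rel_interior \<sigma>"
        using flag_top[OF K less.prems(2)] False by metis
      obtain \<tau> where t: "\<tau> \<in> C" "\<tau> \<in> K" "C - {\<tau>} \<in> flags (proper_faces \<tau>)" "barycenter \<tau> \<in> rel_interior \<tau>"
        using flag_top[OF K less.prems(3)] False by metis
      have flags': "B - {\<sigma>} \<in> flags K" "C - {\<tau>} \<in> flags K"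
        using less.prems flags_subset by blast+
      have card': "card (B - {\<sigma>}) < card B" "card (C - {\<tau>}) < card C"
        using fin s t by (simp_all only: card_Diff1_less)
      show ?thesis
      proof
        fix x assume x: "x \<in> flag_simplex B \<inter> flag_simplex C"
        consider "x \<notin> rel_interior \<sigma>" | "x \<notin> rel_interior \<tau>" | "x \<in> rel_interior \<sigma>" "x \<in> rel_interior \<tau>"
          by blast
        then show "x \<in> flag_simplex (B \<inter> C)"
        proof cases
          case 1
          then have "x \<in> flag_simplex (B - {\<sigma>}) \<inter> flag_simplex C"
            using flag_simplex_rel_interior_top[OF K less.prems(2) s(1,3)] x by blast
          then have "x \<in> flag_simplex ((B - {\<sigma>}) \<inter> C)"
            using less.hyps[of "B - {\<sigma>}" C] card' flags' less.prems K by auto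
          then show ?thesis unfolding flag_simplex_def
            by (meson Diff_subset Int_mono hull_mono image_mono order_refl subsetD)
        next
          case 2
          then have "x \<in> flag_simplex B \<inter> flag_simplex (C - {\<tau>})"
            using flag_simplex_rel_interior_top[OF K less.prems(3) t(1,3)] x by blast
          then have "x \<in> flag_simplex (B \<inter> (C - {\<tau>}))"
            using less.hyps[of B "C - {\<tau>}"] card' flags' less.prems K by auto
          then show ?thesis unfolding flag_simplex_def
            by (meson Diff_subset Int_mono hull_mono image_mono order_refl subsetD)
        next
          case 3
          \<comment> \<open>A point in both relative interiors forces the tops to coincide. Two
            cones with the same apex inside \<open>\<sigma>\<close> and convex bases in its relative
            frontier intersect in the cone over the intersection of the bases.\<close>
          have "\<sigma> \<subseteq> \<tau>" "\<tau> \<subseteq> \<sigma>"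
            using rel_interior_meets_simplex K s t 3 rel_interior_subset by (metis subsetD)+
          then have e: "\<tau> = \<sigma>" by simp
          let ?B = "B - {\<sigma>}" let ?C = "C - {\<sigma>}"
          have "convex (flag_simplex ?B)" "convex (flag_simplex ?C)" by (simp_all add: flag_simplex_def)
          moreover have "flag_simplex ?B \<subseteq> rel_frontier \<sigma>" "flag_simplex ?C \<subseteq> rel_frontier \<sigma>"
            using flags_proper_faces_hull K s t e by blast+
          moreover have "convex \<sigma>" using K s(2) convex_simplex unfolding simplicial_complex_def by blast
          ultimately have "flag_simplex B \<inter> flag_simplex C
              = convex hull (insert (barycenter \<sigma>) (flag_simplex ?B \<inter> flag_simplex ?C))"
            using convex_hull_insert_Int_eq[OF s(4)] flag_simplex_insert_top s t e by metis
          also have "flag_simplex ?B \<inter> flag_simplex ?C = flag_simplex (?B \<inter> ?C)"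
          proof
            show "flag_simplex ?B \<inter> flag_simplex ?C \<subseteq> flag_simplex (?B \<inter> ?C)"
              using less.hyps[of ?B ?C] card' flags' K e by auto
            show "flag_simplex (?B \<inter> ?C) \<subseteq> flag_simplex ?B \<inter> flag_simplex ?C"
              unfolding flag_simplex_def by (simp add: hull_mono image_mono)
          qed
          also have "convex hull (insert (barycenter \<sigma>) (flag_simplex (?B \<inter> ?C))) = flag_simplex (B \<inter> C)"
            using flag_simplex_insert_top[of "B \<inter> C" \<sigma> "?B \<inter> ?C"] s t e by blast
          finally show ?thesis using x by blast
        qed
      qed
    qed (auto simp: flag_simplex_def)
  qed
qed

section \<open>The complex of all flag simplices, a nonrecursive form of the barycentric
  subdivision\<close>

definition subdivision :: "'a::euclidean_space set set \<Rightarrow> 'a set set" where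
  "subdivision K = flag_simplex ` flags K"

lemma verts_flag_simplex:
  assumes "simplicial_complex K" "C \<in> flags K"
  shows "verts (flag_simplex C) = barycenter ` C"
  unfolding verts_def flag_simplex_def
  by (simp add: extreme_point_of_convex_hull_affine_independent[OF flag_affine_independent[OF assms]])

text \<open>The extreme points of the simplex are the barycenters of the flag, and these determine
  its members.\<close>

lemma flag_simplex_inj:
  assumes "simplicial_complex K"
  shows "inj_on flag_simplex (flags K)"
proof (rule inj_onI)
  fix B C assume "B \<in> flags K" "C \<in> flags K" "flag_simplex B = flag_simplex C"
  then show "B = C"
    using verts_flag_simplex[OF assms, of B] verts_flag_simplex[OF assms, of C]
      inj_on_image_eq_iff[OF barycenter_inj[OF assms], of B C]
    by (simp add: flags_def)
qed

lemma card_barycenter_flag: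
  assumes "simplicial_complex K" "C \<in> flags K"
  shows "card (barycenter ` C) = card C"
  using assms(2) inj_on_subset[OF barycenter_inj[OF assms(1)], of C] by (simp add: flags_def card_image)

text \<open>The offset of one between members and dimension also covers the empty flag, of dimension
  -1.\<close>

lemma flag_simplex_simplex:
  assumes "simplicial_complex K" "C \<in> flags K"
  shows "n simplex (flag_simplex C) \<longleftrightarrow> int (card C) = n + 1"
proof -
  have "int (card C) - 1 simplex (flag_simplex C)"
    unfolding simplex_def flag_simplex_def
    using assms by (auto intro!: exI[of _ "barycenter ` C"] simp: flag_affine_independent card_barycenter_flag)
  then show ?thesis using aff_dim_simplex by (metis add_diff_cancel diff_add_cancel)
qed

lemma face_of_flag_simplex:
  assumes "simplicial_complex K" "C \<in> flags K"
  shows "\<rho> face_of flag_simplex C \<longleftrightarrow> (\<exists>B \<subseteq> C. \<rho> = flag_simplex B)"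
  unfolding flag_simplex_def face_of_convex_hull_affine_independent[OF flag_affine_independent[OF assms]]
  by (auto simp: subset_image_iff)

lemma simplicial_complex_subdivision:
  assumes K: "simplicial_complex K"
  shows "simplicial_complex (subdivision K)"
  unfolding simplicial_complex_def
proof (intro conjI allI impI ballI)
  show "finite (subdivision K)"
  proof -
    have "flags K \<subseteq> Pow K" by (auto simp: flags_def)
    then show ?thesis unfolding subdivision_def
      using K unfolding simplicial_complex_def by (meson finite_Pow_iff finite_imageI finite_subset)
  qed
  fix S assume "S \<in> subdivision K"
  then show "\<exists>n. n simplex S" using flag_simplex_simplex[OF K] unfolding subdivision_def
    by (metis diff_add_cancel imageE)
next
  fix F S assume "S \<in> subdivision K \<and> F face_of S"
  then obtain C where C: "C \<in> flags K" "F face_of flag_simplex C" unfolding subdivision_def by auto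
  then obtain B where "B \<subseteq> C" "F = flag_simplex B" using face_of_flag_simplex[OF K C(1)] by auto
  then show "F \<in> subdivision K"
    using flags_subset[OF C(1)] unfolding subdivision_def by simp
next
  fix S S' assume "S \<in> subdivision K \<and> S' \<in> subdivision K"
  then obtain B C where BC: "B \<in> flags K" "S = flag_simplex B" "C \<in> flags K" "S' = flag_simplex C"
    unfolding subdivision_def by auto
  then show "S \<inter> S' face_of S"
    using face_of_flag_simplex[OF K BC(1)] flag_simplex_Int[OF K BC(1,3)] by (metis inf_le1)
qed

text \<open>One inclusion holds since the simplex of a flag lies in the top of the flag. For the
  other, a point is projected radially from the barycenter to the relative frontier, where a proper
  face provides a flag by induction on dimension.\<close>

lemma Union_subdivision:
  assumes K: "simplicial_complex K"
  shows "\<Union>(subdivision K) = \<Union>K"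
proof
  show "\<Union>(subdivision K) \<subseteq> \<Union>K"
  proof clarify
    fix x S assume "x \<in> S" "S \<in> subdivision K"
    then obtain C where C: "C \<in> flags K" "x \<in> flag_simplex C" unfolding subdivision_def by blast
    then have "C \<noteq> {}" by auto
    then obtain \<sigma> where "\<sigma> \<in> C" "\<sigma> \<in> K" "C - {\<sigma>} \<in> flags (proper_faces \<sigma>)"
      using flag_top[OF K C(1)] by metis
    then show "x \<in> \<Union>K" using flag_simplex_rel_interior_top[OF K C(1)] C by blast
  qed
  \<comment> \<open>The flag is sought among the faces of the simplex at hand, so that in the
    induction step \<open>\<sigma>\<close> can be put on top of the flag found in the proper
    face.\<close>
  have "\<exists>C. C \<in> flags {\<tau>. \<tau> face_of \<sigma>} \<and> x \<in> flag_simplex C" if "\<sigma> \<in> K" "x \<in> \<sigma>" for x \<sigma>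
    using that
  proof (induction "nat (aff_dim \<sigma>)" arbitrary: x \<sigma> rule: less_induct)
    case less
    obtain n where n: "n simplex \<sigma>" using K less unfolding simplicial_complex_def by blast
    have ne: "\<sigma> \<noteq> {}" using less by auto
    have b: "barycenter \<sigma> \<in> rel_interior \<sigma>" using n ne barycenter_in_rel_interior by blast
    have sf: "\<sigma> face_of \<sigma>" using n convex_simplex face_of_refl by blast
    show ?case
    proof (cases "x = barycenter \<sigma>")
      case True
      have "insert \<sigma> {} \<in> flags {\<tau>. \<tau> face_of \<sigma>}"
        using ne sf by (intro flags_insert_top) auto
      then show ?thesis using True by (metis flag_simplex_def hull_inc image_insert insertI1)
    next
      case False
      obtain z where z: "z \<in> rel_frontier \<sigma>" "x \<in> closed_segment (barycenter \<sigma>) z"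
        using segment_to_rel_frontier_aux[of \<sigma> "barycenter \<sigma>" x] n b less.prems False
          convex_simplex compact_simplex compact_imp_bounded by metis
      then obtain \<tau> where t: "\<tau> face_of \<sigma>" "\<tau> \<noteq> \<sigma>" "z \<in> \<tau>"
        using rel_frontier_of_polyhedron_alt[OF simplex_imp_polyhedron[OF n]] by blast
      have "aff_dim \<tau> < aff_dim \<sigma>"
        using face_of_aff_dim_lt[OF convex_simplex[OF n] t(1,2)] .
      moreover have "0 \<le> aff_dim \<tau>"
        using t(3) aff_dim_negative_iff[of \<tau>] by (metis empty_iff not_le)
      ultimately have "nat (aff_dim \<tau>) < nat (aff_dim \<sigma>)" by linarith
      moreover have "\<tau> \<in> K" using K t less.prems unfolding simplicial_complex_def by blast
      ultimately obtain C where C: "C \<in> flags {\<rho>. \<rho> face_of \<tau>}" "z \<in> flag_simplex C"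
        using less.hyps[of \<tau> z] t(3) by blast
      have Cs: "C \<in> flags {\<rho>. \<rho> face_of \<sigma>}" "\<sigma> \<notin> C"
        using C(1) t(2) face_of_trans[OF _ t(1)] face_of_imp_subset[OF t(1)]
        unfolding flags_def by (blast, blast dest: face_of_imp_subset)
      have D: "insert \<sigma> C \<in> flags {\<rho>. \<rho> face_of \<sigma>}"
        using Cs sf ne by (intro flags_insert_top) (auto simp: flags_def dest: face_of_imp_subset)
      have "flag_simplex (insert \<sigma> C) = convex hull (insert (barycenter \<sigma>) (flag_simplex C))"
        using flag_simplex_insert_top[of "insert \<sigma> C" \<sigma> C] Cs by auto
      moreover have "closed_segment (barycenter \<sigma>) z \<subseteq> convex hull (insert (barycenter \<sigma>) (flag_simplex C))"
        unfolding segment_convex_hull using C by (intro hull_mono) auto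
      ultimately show ?thesis using D z(2) by (metis subsetD)
    qed
  qed
  moreover have "C \<in> flags K" if "\<sigma> \<in> K" "C \<in> flags {\<tau>. \<tau> face_of \<sigma>}" for \<sigma> C
    using K that unfolding simplicial_complex_def flags_def by blast
  ultimately show "\<Union>K \<subseteq> \<Union>(subdivision K)"
    unfolding subdivision_def by fastforce
qed

section \<open>The recursive subdivision in terms of flags\<close>

lemma face_of_sing_iff: "\<tau> face_of {a} \<longleftrightarrow> \<tau> = {} \<or> \<tau> = {a}"
  by (metis convex_singleton empty_face_of face_of_imp_subset face_of_refl subset_singletonD)

lemma verts_sing [simp]: "verts {a} = {a}"
  by (auto simp: verts_def extreme_point_of_def)

lemma simplex_facet_aff_dim:
  assumes "n simplex \<sigma>"
  shows "\<tau> facet_of \<sigma> \<longleftrightarrow> \<tau> face_of \<sigma> \<and> \<tau> \<noteq> {} \<and> aff_dim \<tau> = n - 1"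
  using assms aff_dim_simplex by (auto simp: facet_of_def)

text \<open>A proper face misses some vertex \<open>u\<close> of the simplex and so lies in the
  facet opposite to \<open>u\<close>.\<close>

lemma proper_face_subset_facet:
  assumes s: "int (Suc n) simplex \<sigma>" and t: "\<tau> \<in> proper_faces \<sigma>"
  obtains \<rho> where "\<rho> facet_of \<sigma>" "\<tau> \<subseteq> \<rho>" "int n simplex \<rho>"
proof -
  obtain V where V: "finite V" "\<not> affine_dependent V" "\<sigma> = convex hull V" "card V = Suc (Suc n)"
    using s by (auto simp: simplex)
  obtain W where W: "W \<subseteq> V" "\<tau> = convex hull W" "W \<noteq> V"
    using t V by (auto simp: proper_faces_def face_of_convex_hull_affine_independent)
  then obtain u where u: "u \<in> V" "u \<notin> W" by auto
  have "int n simplex (convex hull (V - {u}))"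
    unfolding simplex_def using V u
    by (intro exI[of _ "V - {u}"]) (auto simp: affine_independent_Diff)
  moreover have "convex hull (V - {u}) facet_of \<sigma>"
    unfolding V(3) facet_of_convex_hull_affine_independent_alt[OF V(2)] using u V by auto
  moreover have "\<tau> \<subseteq> convex hull (V - {u})"
    unfolding W using W u by (intro hull_mono) auto
  ultimately show thesis using that by blast
qed

lemma simplex_facet_simplex:
  assumes "int (Suc n) simplex \<sigma>" "\<rho> facet_of \<sigma>"
  shows "int n simplex \<rho>" "\<rho> \<in> proper_faces \<sigma>"
proof -
  show p: "\<rho> \<in> proper_faces \<sigma>"
    using assms facet_of_irrefl facet_of_imp_face_of unfolding proper_faces_def by blast
  obtain m where m: "m simplex \<rho>" using assms simplex_face_obtain facet_of_imp_face_of by blast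
  have "aff_dim \<rho> = int n" using simplex_facet_aff_dim[OF assms(1)] assms(2) by simp
  then show "int n simplex \<rho>" using aff_dim_simplex[OF m] m by simp
qed

lemma simplex_join_flag:
  assumes K: "simplicial_complex K" "C \<in> flags K" and "\<sigma> \<in> K" "\<sigma> \<noteq> {}"
  shows "simplex_join {barycenter \<sigma>} (flag_simplex C) = flag_simplex (insert \<sigma> C)"
  unfolding simplex_join_def verts_flag_simplex[OF K]
  by (simp add: flag_simplex_def)

text \<open>The counterpart for flags of the coning in \<open>cone_complex\<close>: a flag of faces
  of \<open>\<sigma>\<close> either avoids \<open>\<sigma>\<close> or has it as its top.\<close>

lemma flags_faces_cases:
  assumes n: "n simplex \<sigma>" and ne: "\<sigma> \<noteq> {}"
  shows "C \<in> flags {\<tau>. \<tau> face_of \<sigma>} \<longleftrightarrow>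
    C \<in> flags (proper_faces \<sigma>) \<or> (\<exists>B \<in> flags (proper_faces \<sigma>). C = insert \<sigma> B)"
proof
  assume C: "C \<in> flags {\<tau>. \<tau> face_of \<sigma>}"
  have "C - {\<sigma>} \<in> flags (proper_faces \<sigma>)"
    using C by (auto simp: flags_def chain_subset_def proper_faces_def)
  then show "C \<in> flags (proper_faces \<sigma>) \<or> (\<exists>B \<in> flags (proper_faces \<sigma>). C = insert \<sigma> B)"
    by (cases "\<sigma> \<in> C") (auto intro: bexI[of _ "C - {\<sigma>}"])
next
  have "insert \<sigma> B \<in> flags {\<tau>. \<tau> face_of \<sigma>}" if "B \<in> flags (proper_faces \<sigma>)" for B
    using that ne face_of_refl[OF convex_simplex[OF n]]
    by (intro flags_insert_top) (auto simp: flags_def proper_faces_def dest: face_of_imp_subset)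
  moreover assume "C \<in> flags (proper_faces \<sigma>) \<or> (\<exists>B \<in> flags (proper_faces \<sigma>). C = insert \<sigma> B)"
  ultimately show "C \<in> flags {\<tau>. \<tau> face_of \<sigma>}"
    by (auto simp: flags_def proper_faces_def)
qed

text \<open>The counterpart for flags of the gluing in \<open>sd_boundary\<close>: a facet that
  contains the top of a flag contains the whole flag.\<close>

lemma subdivision_proper_faces:
  assumes n: "int (Suc n) simplex \<sigma>"
  shows "subdivision (proper_faces \<sigma>) = (\<Union>\<tau>\<in>{\<tau>. \<tau> facet_of \<sigma>}. subdivision {\<rho>. \<rho> face_of \<tau>})"
proof -
  have K: "simplicial_complex (proper_faces \<sigma>)" using simplicial_complex_proper_faces n by blast
  have "\<exists>\<tau>. \<tau> facet_of \<sigma> \<and> C \<in> flags {\<rho>. \<rho> face_of \<tau>}" if C: "C \<in> flags (proper_faces \<sigma>)" for C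
  proof (cases "C = {}")
    case True
    have "{} \<in> proper_faces \<sigma>" using n by (auto simp: proper_faces_def)
    then show ?thesis using proper_face_subset_facet[OF n] True by (metis flags_empty)
  next
    case False
    obtain \<tau> where t: "\<tau> \<in> C" "\<tau> \<in> proper_faces \<sigma>" "C - {\<tau>} \<in> flags (proper_faces \<tau>)"
      using flag_top[OF K C False] by metis
    obtain \<rho> where r: "\<rho> facet_of \<sigma>" "\<tau> \<subseteq> \<rho>" using proper_face_subset_facet[OF n t(2)] by metis
    have "\<tau> face_of \<rho>"
      using t(2) r face_of_subset facet_of_imp_subset unfolding proper_faces_def by blast
    moreover have "\<upsilon> face_of \<tau>" if "\<upsilon> \<in> C" for \<upsilon>
      using t(3) that face_of_refl[OF face_of_imp_convex[OF \<open>\<tau> face_of \<rho>\<close>]]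
      by (cases "\<upsilon> = \<tau>") (auto simp: flags_def proper_faces_def)
    ultimately have "C \<subseteq> {\<upsilon>. \<upsilon> face_of \<rho>}" using face_of_trans by blast
    then show ?thesis using C r flags_mono by blast
  qed
  moreover have "C \<in> flags (proper_faces \<sigma>)" if "\<tau> facet_of \<sigma>" "C \<in> flags {\<rho>. \<rho> face_of \<tau>}" for C \<tau>
  proof -
    have "{\<rho>. \<rho> face_of \<tau>} \<subseteq> proper_faces \<sigma>"
      using K simplex_facet_simplex(2)[OF n that(1)] unfolding simplicial_complex_def by blast
    then show ?thesis using that(2) by (auto simp: flags_def)
  qed
  ultimately have "flags (proper_faces \<sigma>) = (\<Union>\<tau>\<in>{\<tau>. \<tau> facet_of \<sigma>}. flags {\<rho>. \<rho> face_of \<tau>})"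
    by blast
  then show ?thesis unfolding subdivision_def by (simp add: image_UN)
qed

text \<open>Both equations go through one induction because the recursion is mutual. Joining with
  the barycenter of \<open>\<sigma>\<close> amounts to inserting \<open>\<sigma>\<close> into a
  flag.\<close>

lemma sd_simplex_boundary_eq_subdivision:
  assumes "int n simplex \<sigma>"
  shows "sd_simplex n \<sigma> = subdivision {\<tau>. \<tau> face_of \<sigma>} \<and> sd_boundary n \<sigma> = subdivision (proper_faces \<sigma>)"
  using assms
proof (induction n arbitrary: \<sigma>)
  case 0
  then obtain a where a: "\<sigma> = {a}" by (auto simp: simplex_zero)
  have p: "proper_faces \<sigma> = {{}}" by (auto simp: a proper_faces_def face_of_sing_iff)
  have f: "flags (proper_faces \<sigma>) = {{}}" by (auto simp: p flags_def chain_subset_def)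
  have "C \<in> flags {\<tau>. \<tau> face_of \<sigma>} \<longleftrightarrow> C = {} \<or> C = {\<sigma>}" for C
    using flags_faces_cases[OF 0, of C] a f by simp
  then have f': "flags {\<tau>. \<tau> face_of \<sigma>} = {{}, {\<sigma>}}" by blast
  \<comment> \<open>In dimension 0 the recursion keeps the point itself instead of coning from a
    barycenter; the two agree.\<close>
  have "barycenter \<sigma> = a" by (simp add: a barycenter_def verts_sing)
  moreover have "{\<rho>. \<rho> face_of \<sigma>} = {{}, {a}}" unfolding a face_of_sing_iff by auto
  ultimately show ?case unfolding subdivision_def f f' by (simp add: flag_simplex_def)
next
  case (Suc n)
  note s = Suc.prems
  have K: "simplicial_complex (proper_faces \<sigma>)" "simplicial_complex {\<tau>. \<tau> face_of \<sigma>}"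
    using simplicial_complex_proper_faces simplicial_complex_faces s by blast+
  have ne: "\<sigma> \<noteq> {}" using s by auto
  have sf: "\<sigma> face_of \<sigma>" using s convex_simplex face_of_refl by blast
  have b: "sd_boundary (Suc n) \<sigma> = subdivision (proper_faces \<sigma>)"
    unfolding subdivision_proper_faces[OF s] using Suc.IH simplex_facet_simplex[OF s] by auto
  have "simplex_join {barycenter \<sigma>} (flag_simplex C) = flag_simplex (insert \<sigma> C)"
    if "C \<in> flags (proper_faces \<sigma>)" for C
    using simplex_join_flag[OF K(2), of C \<sigma>] that sf ne by (auto simp: flags_def proper_faces_def)
  then have "{simplex_join {barycenter \<sigma>} \<tau> |\<tau>. \<tau> \<in> subdivision (proper_faces \<sigma>)}
      = (\<lambda>C. flag_simplex (insert \<sigma> C)) ` flags (proper_faces \<sigma>)"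
    unfolding subdivision_def by force
  moreover have "flags {\<tau>. \<tau> face_of \<sigma>} = flags (proper_faces \<sigma>) \<union> insert \<sigma> ` flags (proper_faces \<sigma>)"
    using flags_faces_cases[OF s ne] by (simp add: set_eq_iff image_iff)
  ultimately have "sd_simplex (Suc n) \<sigma> = subdivision {\<tau>. \<tau> face_of \<sigma>}"
    unfolding sd_simplex.simps b cone_complex_def by (simp add: subdivision_def image_Un image_image)
  with b show ?case by blast
qed

text \<open>Without \<open>\<sigma>\<close>, the flag lives in some facet. It is completed there by
  induction, with one member in each dimension up to that of the facet, and then
  \<open>\<sigma>\<close> is put on top.\<close>

lemma flag_extend:
  assumes "int n simplex \<sigma>" "C \<in> flags {\<tau>. \<tau> face_of \<sigma>}"
  obtains B where "B \<in> flags {\<tau>. \<tau> face_of \<sigma>}" "C \<subseteq> B" "card B = Suc n" "\<sigma> \<in> B"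
proof -
  have "\<exists>B \<in> flags {\<tau>. \<tau> face_of \<sigma>}. C \<subseteq> B \<and> card B = Suc n \<and> \<sigma> \<in> B"
    using assms
  proof (induction n arbitrary: \<sigma> C)
    case 0
    then obtain a where a: "\<sigma> = {a}" by (auto simp: simplex_zero)
    have "C \<subseteq> {\<sigma>}" using 0 by (auto simp: a flags_def face_of_sing_iff)
    moreover have "{\<sigma>} \<in> flags {\<tau>. \<tau> face_of \<sigma>}"
      by (auto simp: a flags_def face_of_sing_iff chain_subset_def)
    ultimately show ?case by auto
  next
    case (Suc n)
    note s = Suc.prems(1)
    have ne: "\<sigma> \<noteq> {}" using s by auto
    have "C - {\<sigma>} \<in> flags (proper_faces \<sigma>)"
      using Suc.prems(2) by (auto simp: flags_def chain_subset_def proper_faces_def)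
    \<comment> \<open>The facet comes from the decomposition of the subdivided boundary, which
      speaks of simplices; injectivity then identifies the flag \<open>D\<close> found in the facet
      with \<open>C - {\<sigma>}\<close>.\<close>
    then have "flag_simplex (C - {\<sigma>}) \<in> subdivision (proper_faces \<sigma>)" unfolding subdivision_def by blast
    then obtain \<tau> D where t: "\<tau> facet_of \<sigma>" "D \<in> flags {\<rho>. \<rho> face_of \<tau>}"
        "flag_simplex D = flag_simplex (C - {\<sigma>})"
      unfolding subdivision_proper_faces[OF s] by (auto simp: subdivision_def)
    have K: "simplicial_complex (proper_faces \<sigma>)" using simplicial_complex_proper_faces s by blast
    have sub: "{\<rho>. \<rho> face_of \<tau>} \<subseteq> proper_faces \<sigma>"
      using K simplex_facet_simplex(2)[OF s t(1)] unfolding simplicial_complex_def by blast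
    have "D \<in> flags (proper_faces \<sigma>)" using t(2) sub by (auto simp: flags_def)
    then have D: "D = C - {\<sigma>}"
      using flag_simplex_inj[OF K] t(3) \<open>C - {\<sigma>} \<in> flags (proper_faces \<sigma>)\<close> by (auto dest: inj_onD)
    obtain B where B: "B \<in> flags {\<rho>. \<rho> face_of \<tau>}" "D \<subseteq> B" "card B = Suc n"
      using Suc.IH[OF simplex_facet_simplex(1)[OF s t(1)] t(2)] by blast
    have Bp: "B \<in> flags (proper_faces \<sigma>)" using B(1) sub by (auto simp: flags_def)
    then have "insert \<sigma> B \<in> flags {\<tau>. \<tau> face_of \<sigma>}" using flags_faces_cases[OF s ne] by blast
    moreover have "\<sigma> \<notin> B" using Bp by (auto simp: flags_def proper_faces_def)
    moreover have "finite B" using flags_finite[OF K Bp] .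
    ultimately show ?case using B D by (intro bexI[of _ "insert \<sigma> B"]) auto
  qed
  then show thesis using that by blast
qed

text \<open>Dimension drops strictly along a flag of nonempty simplices. The bound is kept as an
  integer \<open>d\<close> that may be -1, which the induction reaches below a vertex; then only the
  empty flag is left.\<close>

lemma card_flag_le:
  assumes "simplicial_complex K" "C \<in> flags K" "\<And>\<tau>. \<tau> \<in> C \<Longrightarrow> aff_dim \<tau> \<le> d" "0 \<le> d + 1"
  shows "int (card C) \<le> d + 1"
  using assms
proof (induction "card C" arbitrary: C K d rule: less_induct)
  case less
  show ?case
  proof (cases "C = {}")
    case True then show ?thesis using less.prems by auto
  next
    case False
    obtain \<sigma> where s: "\<sigma> \<in> C" "\<sigma> \<in> K" "\<sigma> \<noteq> {}" "C - {\<sigma>} \<in> flags (proper_faces \<sigma>)"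
      using flag_top[OF less.prems(1,2) False] by metis
    obtain n where n: "n simplex \<sigma>" using s less.prems unfolding simplicial_complex_def by blast
    have d: "n \<le> d" "0 \<le> n" using n less.prems(3)[OF s(1)] aff_dim_simplex[OF n] s(3)
      by (simp, metis aff_dim_negative_iff linorder_not_le)
    have fin: "finite C" using less.prems flags_finite by blast
    have "aff_dim \<tau> \<le> n - 1" if "\<tau> \<in> C - {\<sigma>}" for \<tau>
      using simplex_aff_dim_face_less[OF n, of \<tau>] that s(4) by (auto simp: flags_def proper_faces_def)
    then have "int (card (C - {\<sigma>})) \<le> n - 1 + 1"
      using s fin d by (intro less.hyps[OF _ simplicial_complex_proper_faces[OF n]]) (auto simp only: card_Diff1_less)
    moreover have "card C = Suc (card (C - {\<sigma>}))" using s fin by (metis card_Suc_Diff1)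
    ultimately show ?thesis using d by linarith
  qed
qed

section \<open>Euclidean charts\<close>

text \<open>Bounded convex sets of equal affine dimension have homeomorphic relative frontiers. The
  simplex is compared with the unit ball of a coordinate subspace.\<close>

lemma simplex_rel_frontier_homeomorphic_nsphere:
  fixes \<sigma> :: "'a::euclidean_space set"
  assumes "int (Suc n) simplex \<sigma>"
  shows "top_of_set (rel_frontier \<sigma>) homeomorphic_space nsphere n"
proof -
  \<comment> \<open>The simplex itself shows that the ambient space has room for a coordinate
    subspace of dimension \<open>Suc n\<close>.\<close>
  have "Suc n \<le> card (Basis :: 'a set)"
    using aff_dim_simplex[OF assms] aff_dim_le_DIM[of \<sigma>] by simp
  then obtain B :: "'a set" where B: "B \<subseteq> Basis" "card B = Suc n"
    using obtain_subset_with_card_n by metis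
  have ind: "independent B" using B(1) independent_Basis independent_mono by blast
  define L where "L = span B"
  have L: "subspace L" "aff_dim L = int (Suc n)"
    using B(2) by (simp_all add: L_def aff_dim_subspace dim_eq_card_independent[OF ind])
  have "pairwise orthogonal B" "\<And>u. u \<in> B \<Longrightarrow> norm u = 1"
    using B(1) pairwise_subset[OF orthogonal_Basis] by auto
  then have 1: "nsphere n homeomorphic_space top_of_set (sphere 0 1 \<inter> L)"
    unfolding L_def homeomorphic_space_def
    using homeomorphic_maps_nsphere_euclidean_sphere[OF ind _ B(2)] by (metis diff_Suc_1 nat.distinct(2))
  have ne: "interior (cball 0 1) \<inter> L \<noteq> {}" using subspace_0[OF L(1)] by (metis IntI centre_in_ball empty_iff interior_cball zero_less_one)
  have "rel_frontier (cball 0 1 \<inter> L) = sphere 0 1 \<inter> L"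
    using convex_affine_rel_frontier_Int[OF convex_cball subspace_imp_affine[OF L(1)] ne] by simp
  moreover have "rel_frontier \<sigma> homeomorphic rel_frontier (cball 0 1 \<inter> L)"
  proof (rule homeomorphic_rel_frontiers_convex_bounded_sets)
    show "convex \<sigma>" "bounded \<sigma>" using assms convex_simplex compact_simplex compact_imp_bounded by blast+
    show "convex (cball 0 1 \<inter> L)" using L(1) by (simp add: convex_Int subspace_imp_convex)
    show "bounded (cball 0 1 \<inter> L)" by (simp add: bounded_Int)
    have "aff_dim (L \<inter> cball 0 1) = aff_dim L"
      using ne L(1) by (intro aff_dim_convex_Int_nonempty_interior) (simp_all add: subspace_imp_convex inf_commute)
    then show "aff_dim \<sigma> = aff_dim (cball 0 1 \<inter> L)"
      using aff_dim_simplex[OF assms] L(2) by (simp add: inf_commute)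
  qed
  ultimately have "top_of_set (rel_frontier \<sigma>) homeomorphic_space top_of_set (sphere 0 1 \<inter> L)"
    by (simp add: homeomorphic_space_iff_homeomorphic)
  then show ?thesis using 1 by (metis homeomorphic_space_sym homeomorphic_space_trans)
qed

text \<open>The charts take values in affine subspaces of the ambient space rather than in
  \<open>Euclidean_space D\<close>, the form in which invariance of domain and of dimension are
  available for affine sets.\<close>

definition euclidean_charts :: "nat \<Rightarrow> 'a::euclidean_space set \<Rightarrow> bool" where
  "euclidean_charts D T \<longleftrightarrow>
     (\<forall>x\<in>T. \<exists>W L V h g. openin (top_of_set T) W \<and> x \<in> W \<and> affine (L :: 'a set) \<and> aff_dim L = int D \<and>
        openin (top_of_set L) V \<and> homeomorphism W V h g)"

lemma euclidean_chartsE: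
  fixes T :: "'a::euclidean_space set"
  assumes "euclidean_charts D T" "x \<in> T"
  obtains W V h g and L :: "'a set" where "openin (top_of_set T) W" "x \<in> W" "affine L" "aff_dim L = int D"
    "openin (top_of_set L) V" "homeomorphism W V h g"
  using assms unfolding euclidean_charts_def by meson

text \<open>A chart of \<open>M\<close> is pulled back along the homeomorphism \<open>p\<close> and
  its target is moved from \<open>Euclidean_space D\<close> to \<open>L\<close>.\<close>

lemma locally_Euclidean_charts:
  fixes T :: "'a::euclidean_space set"
  assumes M: "locally_Euclidean_space D M" and T: "top_of_set T homeomorphic_space M"
    and L: "affine (L :: 'a set)" "aff_dim L = int D"
  shows "euclidean_charts D T"
  unfolding euclidean_charts_def
proof
  fix x assume x: "x \<in> T"
  obtain p q where pq: "homeomorphic_maps (top_of_set T) M p q"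
    using T by (auto simp: homeomorphic_space_def)
  have px: "p x \<in> topspace M" using pq x by (auto simp: homeomorphic_maps_def continuous_map_def)
  obtain U V where UV: "openin M U" "p x \<in> U" "openin (Euclidean_space D) V"
    "subtopology M U homeomorphic_space subtopology (Euclidean_space D) V"
    using M px unfolding locally_Euclidean_space_def by blast
  define W where "W = {y \<in> T. p y \<in> U}"
  have xW: "x \<in> W" using x UV(2) by (simp add: W_def)
  have W: "openin (top_of_set T) W"
    using openin_continuous_map_preimage[of "top_of_set T" M p U] pq UV(1)
    by (simp add: homeomorphic_maps_def W_def)
  have "homeomorphic_map (subtopology (top_of_set T) W) (subtopology M U) p"
    using pq by (intro homeomorphic_map_subtopologies_alt) (auto simp: homeomorphic_map_maps W_def)
  then have 1: "top_of_set W homeomorphic_space subtopology M U"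
    using openin_imp_subset[OF W]
    by (metis homeomorphic_map_imp_homeomorphic_space inf.absorb_iff2 subtopology_subtopology)
  obtain f where fmap: "homeomorphic_map (Euclidean_space D) (top_of_set L) f"
    using homeomorphic_affine_Euclidean_space[OF L(1), of D] L(2) homeomorphic_space homeomorphic_space_sym by blast
  have V': "openin (top_of_set L) (f ` V)"
    using homeomorphic_map_openness[OF fmap openin_subset[OF UV(3)]] UV(3) by blast
  have "homeomorphic_map (subtopology (Euclidean_space D) V) (subtopology (top_of_set L) (f ` V)) f"
    using openin_subset[OF UV(3)] openin_subset[OF V'] by (intro homeomorphic_map_subtopologies[OF fmap]) auto
  then have 2: "subtopology (Euclidean_space D) V homeomorphic_space top_of_set (f ` V)"
    using openin_imp_subset[OF V']
    by (metis homeomorphic_map_imp_homeomorphic_space inf.absorb_iff2 subtopology_subtopology)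
  have "top_of_set W homeomorphic_space top_of_set (f ` V)"
    by (rule homeomorphic_space_trans[OF homeomorphic_space_trans[OF 1 UV(4)] 2])
  then have "W homeomorphic f ` V" by (simp add: homeomorphic_space_iff_homeomorphic)
  then obtain h k where "homeomorphism W (f ` V) h k" by (auto simp: homeomorphic_def)
  then show "\<exists>W L V h g. openin (top_of_set T) W \<and> x \<in> W \<and> affine (L :: 'a set) \<and> aff_dim L = int D \<and>
        openin (top_of_set L) V \<and> homeomorphism W V h g"
    using W V' L xW by metis
qed

text \<open>Openness is checked near each image point. On the part of \<open>N\<close> mapped into
  one chart domain, \<open>\<phi>\<close> followed by the chart is an injective continuous map
  between affine sets of dimension \<open>D\<close>, hence open; the inverse chart carries its image
  back.\<close>

lemma invariance_of_domain_charts: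
  fixes T :: "'a::euclidean_space set" and \<phi> :: "'c::euclidean_space \<Rightarrow> 'a"
  assumes T: "euclidean_charts D T" and A: "affine A" "aff_dim A = int D"
    and N: "openin (top_of_set A) N" and \<phi>: "continuous_on N \<phi>" "\<phi> ` N \<subseteq> T" "inj_on \<phi> N"
  shows "openin (top_of_set T) (\<phi> ` N)"
proof (subst openin_subopen, intro ballI)
  fix y assume y: "y \<in> \<phi> ` N"
  then have "y \<in> T" using \<phi> by blast
  from euclidean_chartsE[OF T this] obtain W V h g and L :: "'a set" where
    W: "openin (top_of_set T) W" "y \<in> W" and L: "affine L" "aff_dim L = int D"
    and V: "openin (top_of_set L) V" and h: "homeomorphism W V h g" by metis
  define N' where "N' = {a \<in> N. \<phi> a \<in> W}"
  have "openin (top_of_set N) N'"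
    using continuous_openin_preimage[OF \<phi>(1) _ W(1)] \<phi>(2)
    by (simp add: N'_def image_subset_iff_funcset vimage_def Int_def)
  then have N': "openin (top_of_set A) N'" using N openin_trans by blast
  have sub: "N' \<subseteq> N" "\<phi> ` N' \<subseteq> W" by (auto simp: N'_def)
  have "openin (top_of_set L) ((h \<circ> \<phi>) ` N')"
  proof (rule Further_Topology.invariance_of_domain_affine_sets[OF N' A(1) L(1)])
    show "aff_dim L \<le> aff_dim A" using L A by simp
    show "continuous_on N' (h \<circ> \<phi>)"
      using \<phi>(1) sub h by (intro continuous_on_compose) (auto simp: homeomorphism_def intro: continuous_on_subset)
    show "h \<circ> \<phi> \<in> N' \<rightarrow> L"
      using sub h openin_imp_subset[OF V] by (fastforce simp: homeomorphism_def)
    have "inj_on h W" using h by (auto simp: homeomorphism_def intro: inj_on_inverseI)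
    then show "inj_on (h \<circ> \<phi>) N'"
      using sub \<phi>(3) by (meson comp_inj_on inj_on_subset)
  qed
  moreover have "(h \<circ> \<phi>) ` N' \<subseteq> V" using sub h by (auto simp: homeomorphism_def)
  ultimately have "openin (top_of_set V) ((h \<circ> \<phi>) ` N')"
    using openin_imp_subset[OF V] openin_subset_trans by blast
  then have "openin (top_of_set W) (g ` (h \<circ> \<phi>) ` N')"
    using homeomorphism_imp_open_map[OF homeomorphism_symD[OF h]] by blast
  moreover have "g ` (h \<circ> \<phi>) ` N' = \<phi> ` N'"
  proof -
    have "g (h (\<phi> a)) = \<phi> a" if "a \<in> N'" for a using that sub h by (auto simp: homeomorphism_def)
    then show ?thesis by (force simp: image_image)
  qed
  ultimately have "openin (top_of_set T) (\<phi> ` N')" using W(1) openin_trans by metis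
  moreover have "y \<in> \<phi> ` N'" using y W(2) by (auto simp: N'_def)
  moreover have "\<phi> ` N' \<subseteq> \<phi> ` N" using sub by blast
  ultimately show "\<exists>S. openin (top_of_set T) S \<and> y \<in> S \<and> S \<subseteq> \<phi> ` N" by blast
qed

text \<open>Near a point of \<open>N\<close> the inverse chart embeds an open subset of a
  \<open>D\<close>-dimensional affine set into \<open>A\<close>. Invariance of dimension gives the
  first claim and invariance of domain the second.\<close>

lemma charts_open_in_affine:
  fixes T :: "'a::euclidean_space set"
  assumes T: "euclidean_charts D T" and A: "affine A" "N \<subseteq> A"
    and N: "openin (top_of_set T) N"
  shows "N \<noteq> {} \<Longrightarrow> int D \<le> aff_dim A"
    and "aff_dim A \<le> int D \<Longrightarrow> openin (top_of_set A) N"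
proof -
  have loc: "\<exists>N'. y \<in> N' \<and> N' \<subseteq> N \<and> int D \<le> aff_dim A \<and>
      (aff_dim A \<le> int D \<longrightarrow> openin (top_of_set A) N')" if y: "y \<in> N" for y
  proof -
    have "y \<in> T" using y openin_imp_subset[OF N] by blast
    from euclidean_chartsE[OF T this] obtain W V h g and L :: "'a set" where
      W: "openin (top_of_set T) W" "y \<in> W" and L: "affine L" "aff_dim L = int D"
      and V: "openin (top_of_set L) V" and h: "homeomorphism W V h g" by metis
    define N' where "N' = N \<inter> W"
    have "openin (top_of_set T) N'" using N W(1) by (simp add: N'_def openin_Int)
    then have "openin (top_of_set W) N'"
      using openin_imp_subset[OF W(1)] by (auto simp: N'_def intro: openin_subset_trans)
    then have "openin (top_of_set V) (h ` N')" using homeomorphism_imp_open_map[OF h] by blast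
    then have hN: "openin (top_of_set L) (h ` N')" using V openin_trans by blast
    have gh: "g (h a) = a" if "a \<in> N'" for a using that h by (auto simp: homeomorphism_def N'_def)
    have sub: "h ` N' \<subseteq> V" using h by (auto simp: homeomorphism_def N'_def)
    have cont: "continuous_on (h ` N') g" using h sub continuous_on_subset by (auto simp: homeomorphism_def)
    have im: "g \<in> h ` N' \<rightarrow> A" using gh A(2) by (auto simp: N'_def)
    have inj: "inj_on g (h ` N')" using gh by (auto simp: inj_on_def)
    have yN: "y \<in> N'" using y W by (simp add: N'_def)
    then have "h ` N' \<noteq> {}" by blast
    then have "int D \<le> aff_dim A"
      using Further_Topology.invariance_of_dimension_affine_sets[OF hN L(1) A(1) cont im inj] L(2) by simp
    moreover have "openin (top_of_set A) N'" if "aff_dim A \<le> int D"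
    proof -
      have "openin (top_of_set A) (g ` h ` N')"
        using Further_Topology.invariance_of_domain_affine_sets[OF hN L(1) A(1) _ cont im inj] that L(2) by simp
      then show ?thesis using gh by (simp add: image_image)
    qed
    moreover have "N' \<subseteq> N" by (simp add: N'_def)
    ultimately show ?thesis using yN by blast
  qed
  show "int D \<le> aff_dim A" if "N \<noteq> {}" using loc that by blast
  show "openin (top_of_set A) N" if "aff_dim A \<le> int D"
    using loc that by (subst openin_subopen) blast
qed

section \<open>Subdivided pseudomanifolds are colexes\<close>

text \<open>A closed pseudomanifold without strong connectedness, in keeping with manifolds that may
  be disconnected. The guard on \<open>D\<close> is there because for \<open>D = 0\<close> the ridge
  would be the empty simplex, which lies in every vertex.\<close>

definition pseudomanifold_complex :: "nat \<Rightarrow> 'a::euclidean_space set set \<Rightarrow> bool" where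
  "pseudomanifold_complex D K \<longleftrightarrow>
     simplicial_complex K \<and> simplices (int D) K \<noteq> {} \<and>
     (\<forall>\<sigma>\<in>K. \<exists>\<delta>\<in>simplices (int D) K. \<sigma> \<subseteq> \<delta>) \<and>
     (D \<ge> 1 \<longrightarrow> (\<forall>\<tau>\<in>simplices (int D - 1) K. card {\<delta>\<in>simplices (int D) K. \<tau> \<subseteq> \<delta>} = 2))"

text \<open>A ridge of the boundary omits exactly two of the \<open>n + 2\<close> vertices of
  \<open>\<sigma>\<close>, and the facets containing it are those opposite to one of these
  two.\<close>

lemma pseudomanifold_proper_faces:
  assumes s: "int (Suc n) simplex \<sigma>"
  shows "pseudomanifold_complex n (proper_faces \<sigma>)"
  unfolding pseudomanifold_complex_def
proof (intro conjI impI ballI)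
  show "simplicial_complex (proper_faces \<sigma>)" using simplicial_complex_proper_faces s by blast
  have pure: "\<exists>\<delta>\<in>simplices (int n) (proper_faces \<sigma>). \<tau> \<subseteq> \<delta>" if "\<tau> \<in> proper_faces \<sigma>" for \<tau>
    using proper_face_subset_facet[OF s that] simplex_facet_simplex(2)[OF s]
    unfolding simplices_def by (metis (mono_tags, lifting) mem_Collect_eq)
  then show "\<And>\<tau>. \<tau> \<in> proper_faces \<sigma> \<Longrightarrow> \<exists>\<delta>\<in>simplices (int n) (proper_faces \<sigma>). \<tau> \<subseteq> \<delta>" .
  have "{} \<in> proper_faces \<sigma>" using s by (auto simp: proper_faces_def)
  then show "simplices (int n) (proper_faces \<sigma>) \<noteq> {}" using pure by blast
  fix \<tau> assume "1 \<le> n" and "\<tau> \<in> simplices (int n - 1) (proper_faces \<sigma>)"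
  then have t: "int n - 1 simplex \<tau>" "\<tau> face_of \<sigma>" by (auto simp: simplices_def proper_faces_def)
  obtain V where V: "finite V" "\<not> affine_dependent V" "\<sigma> = convex hull V" "card V = Suc (Suc n)"
    using s by (auto simp: simplex)
  obtain W where W: "W \<subseteq> V" "\<tau> = convex hull W"
    using t V by (auto simp: face_of_convex_hull_affine_independent)
  have Wi: "\<not> affine_dependent W" using V W affine_independent_subset by blast
  then have "int (card W) - 1 simplex \<tau>" unfolding simplex_def W by auto
  then have "int (card W) - 1 = int n - 1" using t(1) aff_dim_simplex by metis
  then have "card W = n" by simp
  then have c: "card (V - W) = 2" using V W by (simp add: card_Diff_subset finite_subset)
  \<comment> \<open>By affine independence a facet does not contain the vertex opposite to it, so
    facets are told apart by the vertex they omit.\<close>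
  have out: "v \<notin> convex hull (V - {v})" if "v \<in> V" for v
    using V(2) that convex_hull_subset_affine_hull unfolding affine_dependent_def by blast
  have "{\<delta>\<in>simplices (int n) (proper_faces \<sigma>). \<tau> \<subseteq> \<delta>} = (\<lambda>v. convex hull (V - {v})) ` (V - W)"
  proof (intro equalityI subsetI)
    fix \<delta> assume "\<delta> \<in> {\<delta>\<in>simplices (int n) (proper_faces \<sigma>). \<tau> \<subseteq> \<delta>}"
    then have d: "int n simplex \<delta>" "\<delta> face_of \<sigma>" "\<tau> \<subseteq> \<delta>" by (auto simp: simplices_def proper_faces_def)
    have "\<delta> \<noteq> {}" using d(1) by auto
    then have "\<delta> facet_of \<sigma>" using simplex_facet_aff_dim[OF s] d aff_dim_simplex[OF d(1)] by simp
    then obtain v where v: "v \<in> V" "\<delta> = convex hull (V - {v})"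
      unfolding V(3) facet_of_convex_hull_affine_independent_alt[OF V(2)] by blast
    moreover have "v \<notin> W" using out[OF v(1)] d(3) v W hull_inc by (metis subsetD)
    ultimately show "\<delta> \<in> (\<lambda>v. convex hull (V - {v})) ` (V - W)" by blast
  next
    fix \<delta> assume "\<delta> \<in> (\<lambda>v. convex hull (V - {v})) ` (V - W)"
    then obtain v where v: "v \<in> V" "v \<notin> W" "\<delta> = convex hull (V - {v})" by blast
    then have "\<delta> facet_of \<sigma>"
      unfolding V(3) facet_of_convex_hull_affine_independent_alt[OF V(2)] using V by auto
    moreover have "\<tau> \<subseteq> \<delta>" unfolding W v using W v by (intro hull_mono) auto
    ultimately show "\<delta> \<in> {\<delta>\<in>simplices (int n) (proper_faces \<sigma>). \<tau> \<subseteq> \<delta>}"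
      using simplex_facet_simplex[OF s] by (simp add: simplices_def)
  qed
  moreover have "inj_on (\<lambda>v. convex hull (V - {v})) (V - W)"
  proof (rule inj_onI)
    fix u v assume uv: "u \<in> V - W" "v \<in> V - W" "convex hull (V - {u}) = convex hull (V - {v})"
    show "u = v"
    proof (rule ccontr)
      assume "u \<noteq> v"
      then have "u \<in> convex hull (V - {v})" using uv by (intro hull_inc) auto
      then show False using out[of u] uv by auto
    qed
  qed
  ultimately show "card {\<delta>\<in>simplices (int n) (proper_faces \<sigma>). \<tau> \<subseteq> \<delta>} = 2"
    using c by (simp add: card_image)
qed

text \<open>A \<open>(D - 1)\<close>-simplex of the subdivided boundary is a flag with
  \<open>D\<close> members; joining it with the centre adds \<open>\<delta>\<close> and completes
  it.\<close>

lemma ball_simplices_flags: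
  assumes d: "int D simplex \<delta>"
  shows "ball_simplices D (barycenter \<delta>) (subdivision (proper_faces \<delta>))
    = flag_simplex ` {C \<in> flags {\<tau>. \<tau> face_of \<delta>}. card C = Suc D \<and> \<delta> \<in> C}"
proof -
  have K: "simplicial_complex (proper_faces \<delta>)" "simplicial_complex {\<tau>. \<tau> face_of \<delta>}"
    using simplicial_complex_proper_faces simplicial_complex_faces d by blast+
  have ne: "\<delta> \<noteq> {}" using d by auto
  have sf: "\<delta> face_of \<delta>" using d convex_simplex face_of_refl by blast
  have j: "simplex_join {barycenter \<delta>} (flag_simplex B) = flag_simplex (insert \<delta> B)"
    "insert \<delta> B \<in> flags {\<tau>. \<tau> face_of \<delta>}" "card (insert \<delta> B) = Suc (card B)"
    if "B \<in> flags (proper_faces \<delta>)" for B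
  proof -
    show f: "insert \<delta> B \<in> flags {\<tau>. \<tau> face_of \<delta>}" using flags_faces_cases[OF d ne] that by blast
    show "simplex_join {barycenter \<delta>} (flag_simplex B) = flag_simplex (insert \<delta> B)"
      using simplex_join_flag[OF K(2) flags_subset[OF f subset_insertI]] sf ne by blast
    have "\<delta> \<notin> B" using that by (auto simp: flags_def proper_faces_def)
    then show "card (insert \<delta> B) = Suc (card B)" using flags_finite[OF K(1) that] by simp
  qed
  have i: "flag_simplex B \<in> simplices (int D - 1) (subdivision (proper_faces \<delta>)) \<longleftrightarrow> card B = D"
    if "B \<in> flags (proper_faces \<delta>)" for B
    unfolding simplices_def using that flag_simplex_simplex[OF K(1) that] by (simp add: subdivision_def)
  show ?thesis
  proof (intro equalityI subsetI)
    fix S assume "S \<in> ball_simplices D (barycenter \<delta>) (subdivision (proper_faces \<delta>))"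
    then obtain \<tau> where t: "S = simplex_join {barycenter \<delta>} \<tau>"
      "\<tau> \<in> simplices (int D - 1) (subdivision (proper_faces \<delta>))" unfolding ball_simplices_def by blast
    then obtain B where B: "B \<in> flags (proper_faces \<delta>)" "\<tau> = flag_simplex B"
      by (auto simp: simplices_def subdivision_def)
    have "insert \<delta> B \<in> {C \<in> flags {\<tau>. \<tau> face_of \<delta>}. card C = Suc D \<and> \<delta> \<in> C}"
      using j[OF B(1)] i[OF B(1)] t B(2) by simp
    then show "S \<in> flag_simplex ` {C \<in> flags {\<tau>. \<tau> face_of \<delta>}. card C = Suc D \<and> \<delta> \<in> C}"
      unfolding t(1) B(2) j(1)[OF B(1)] by (rule imageI)
  next
    fix S assume "S \<in> flag_simplex ` {C \<in> flags {\<tau>. \<tau> face_of \<delta>}. card C = Suc D \<and> \<delta> \<in> C}"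
    then obtain C where C: "S = flag_simplex C" "C \<in> flags {\<tau>. \<tau> face_of \<delta>}" "card C = Suc D" "\<delta> \<in> C"
      by blast
    have B: "C - {\<delta>} \<in> flags (proper_faces \<delta>)"
      using C(2) by (auto simp: flags_def chain_subset_def proper_faces_def)
    have "card (C - {\<delta>}) = D" using C by simp
    then have "flag_simplex (C - {\<delta>}) \<in> simplices (int D - 1) (subdivision (proper_faces \<delta>))"
      using i[OF B] by simp
    moreover have "S = simplex_join {barycenter \<delta>} (flag_simplex (C - {\<delta>}))"
      using j(1)[OF B] C by (simp add: insert_absorb)
    ultimately show "S \<in> ball_simplices D (barycenter \<delta>) (subdivision (proper_faces \<delta>))"
      unfolding ball_simplices_def by blast
  qed
qed

text \<open>Every flag of faces of \<open>\<delta>\<close> extends to a complete one ending in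
  \<open>\<delta>\<close>, so its simplex is a face of one of the generating simplices.\<close>

lemma ball_complex_flags:
  assumes d: "int D simplex \<delta>"
  shows "ball_complex D (barycenter \<delta>) (subdivision (proper_faces \<delta>)) = subdivision {\<tau>. \<tau> face_of \<delta>}"
proof -
  have K: "simplicial_complex {\<tau>. \<tau> face_of \<delta>}" using simplicial_complex_faces d by blast
  show ?thesis
  proof (intro equalityI subsetI)
    fix S assume "S \<in> ball_complex D (barycenter \<delta>) (subdivision (proper_faces \<delta>))"
    then obtain C where "C \<in> flags {\<tau>. \<tau> face_of \<delta>}" "S face_of flag_simplex C"
      unfolding ball_complex_def generated_complex_def ball_simplices_flags[OF d] by blast
    then show "S \<in> subdivision {\<tau>. \<tau> face_of \<delta>}"
      using simplicial_complex_subdivision[OF K] unfolding simplicial_complex_def subdivision_def by blast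
  next
    fix S assume "S \<in> subdivision {\<tau>. \<tau> face_of \<delta>}"
    then obtain C where C: "C \<in> flags {\<tau>. \<tau> face_of \<delta>}" "S = flag_simplex C"
      unfolding subdivision_def by blast
    obtain B where B: "B \<in> flags {\<tau>. \<tau> face_of \<delta>}" "C \<subseteq> B" "card B = Suc D" "\<delta> \<in> B"
      using flag_extend[OF d C(1)] by metis
    have "S face_of flag_simplex B" using face_of_flag_simplex[OF K B(1)] C(2) B(2) by blast
    then show "S \<in> ball_complex D (barycenter \<delta>) (subdivision (proper_faces \<delta>))"
      unfolding ball_complex_def generated_complex_def ball_simplices_flags[OF d] using B by blast
  qed
qed

section \<open>Vertices and flags of the whole complex\<close>

lemma complex_vertices_subdivision:
  assumes K: "simplicial_complex K"
  shows "complex_vertices (subdivision K) = barycenter ` (K - {{}})"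
proof (intro equalityI subsetI)
  fix v assume "v \<in> complex_vertices (subdivision K)"
  then obtain C where C: "C \<in> flags K" "{v} = flag_simplex C"
    by (auto simp: complex_vertices_def subdivision_def)
  have "0 simplex flag_simplex C" unfolding C(2)[symmetric] by simp
  then have "card C = 1" using flag_simplex_simplex[OF K C(1)] by simp
  then obtain \<sigma> where "C = {\<sigma>}" by (auto simp: card_1_singleton_iff)
  then show "v \<in> barycenter ` (K - {{}})" using C by (auto simp: flag_simplex_def flags_def)
next
  fix v assume "v \<in> barycenter ` (K - {{}})"
  then obtain \<sigma> where s: "v = barycenter \<sigma>" "\<sigma> \<in> K" "\<sigma> \<noteq> {}" by blast
  have "{\<sigma>} \<in> flags K" using s by (auto simp: flags_def chain_subset_def)
  moreover have "{v} = flag_simplex {\<sigma>}" by (simp add: s flag_simplex_def)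
  ultimately show "v \<in> complex_vertices (subdivision K)"
    by (auto simp: complex_vertices_def subdivision_def)
qed

text \<open>By purity the top of a flag lies in some \<open>D\<close>-simplex, and all smaller
  members are faces of it. Hence subdividing only the \<open>D\<close>-simplices yields the whole
  subdivision.\<close>

lemma pseudomanifold_flags:
  assumes "pseudomanifold_complex D K"
  shows "flags K = (\<Union>\<delta>\<in>simplices (int D) K. flags {\<tau>. \<tau> face_of \<delta>})"
proof (intro equalityI subsetI)
  have K: "simplicial_complex K" using assms by (simp add: pseudomanifold_complex_def)
  {
    fix C assume C: "C \<in> flags K"
    show "C \<in> (\<Union>\<delta>\<in>simplices (int D) K. flags {\<tau>. \<tau> face_of \<delta>})"
    proof (cases "C = {}")
      case True then show ?thesis using assms by (auto simp: pseudomanifold_complex_def)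
    next
      case False
      obtain \<sigma> where s: "\<sigma> \<in> C" "\<sigma> \<in> K" "C - {\<sigma>} \<in> flags (proper_faces \<sigma>)"
        using flag_top[OF K C False] by metis
      obtain \<delta> where d: "\<delta> \<in> simplices (int D) K" "\<sigma> \<subseteq> \<delta>"
        using assms s(2) unfolding pseudomanifold_complex_def by blast
      have "\<sigma> face_of \<delta>" using simplicial_complex_face[OF K s(2) _ d(2)] d by (simp add: simplices_def)
      moreover have "\<tau> face_of \<sigma>" if "\<tau> \<in> C - {\<sigma>}" for \<tau>
        using that s(3) by (auto simp: flags_def proper_faces_def)
      ultimately have "C \<subseteq> {\<tau>. \<tau> face_of \<delta>}" using face_of_trans by blast
      then show ?thesis using flags_mono[OF C] d by blast
    qed
  next
    fix C assume "C \<in> (\<Union>\<delta>\<in>simplices (int D) K. flags {\<tau>. \<tau> face_of \<delta>})"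
    then show "C \<in> flags K"
      using K unfolding simplicial_complex_def flags_def simplices_def by blast
  }
qed

lemma card_flag_le_top:
  assumes K: "simplicial_complex K" "C \<in> flags K" "\<sigma> \<in> C" "C - {\<sigma>} \<in> flags (proper_faces \<sigma>)"
    and n: "n simplex \<sigma>"
  shows "int (card C) \<le> n + 1"
proof (rule card_flag_le[OF K(1,2)])
  show "0 \<le> n + 1" using simplex_dim_ge[OF n] by simp
  fix \<tau> assume "\<tau> \<in> C"
  then have "\<tau> \<subseteq> \<sigma>" using K(4) by (cases "\<tau> = \<sigma>") (auto simp: flags_def proper_faces_def dest: face_of_imp_subset)
  then show "aff_dim \<tau> \<le> n" using aff_dim_simplex[OF n] aff_dim_subset by metis
qed

text \<open>Colorability of the balls is assumed here, so that the lemma can serve both inside the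
  induction, for the boundary of a simplex, and afterwards for the given complex.\<close>

lemma colex_subdivision_if_balls:
  fixes K :: "'a::euclidean_space set set"
  assumes P: "pseudomanifold_complex D K"
    and c: "\<And>\<sigma>. \<sigma> \<in> K - {{}} \<Longrightarrow> c (barycenter \<sigma>) = nat (aff_dim \<sigma>)"
    and balls: "\<And>\<delta>. \<delta> \<in> simplices (int D) K \<Longrightarrow>
      colorable_ball D (barycenter \<delta>) (subdivision (proper_faces \<delta>))"
  shows "colex D (subdivision K)
    {(barycenter \<delta>, subdivision (proper_faces \<delta>)) | \<delta>. \<delta> \<in> simplices (int D) K} c"
proof -
  have K: "simplicial_complex K" using P by (simp add: pseudomanifold_complex_def)
  define S where "S = simplices (int D) K"
  define ball where "ball \<delta> = (barycenter \<delta>, subdivision (proper_faces \<delta>))" for \<delta> :: "'a set"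
  have pure: "\<forall>\<sigma>\<in>K. \<exists>\<delta>\<in>S. \<sigma> \<subseteq> \<delta>" using P by (simp add: pseudomanifold_complex_def S_def)
  have ballset: "{(barycenter \<delta>, subdivision (proper_faces \<delta>)) | \<delta>. \<delta> \<in> simplices (int D) K} = ball ` S"
    unfolding S_def ball_def by blast
  have finS: "finite S" using K unfolding S_def simplices_def simplicial_complex_def by simp
  have S: "int D simplex \<delta>" "\<delta> \<in> K" "\<delta> \<noteq> {}" if "\<delta> \<in> S" for \<delta>
    using that by (auto simp: S_def simplices_def)
  have faces: "{\<tau>. \<tau> face_of \<delta>} \<subseteq> K" if "\<delta> \<in> S" for \<delta>
    using S(2)[OF that] K unfolding simplicial_complex_def by blast
  have flagsK: "C \<in> flags K" if "\<delta> \<in> S" "C \<in> flags {\<tau>. \<tau> face_of \<delta>}" for C \<delta>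
    using that(2) faces[OF that(1)] by (auto simp: flags_def)
  have bflagsK: "C \<in> flags K" if "\<delta> \<in> S" "C \<in> flags (proper_faces \<delta>)" for C \<delta>
    using that(2) faces[OF that(1)] by (auto simp: flags_def proper_faces_def)
  have noface: "\<not> \<delta> face_of \<epsilon>" if "\<delta> \<in> S" "\<epsilon> \<in> S" "\<delta> \<noteq> \<epsilon>" for \<delta> \<epsilon>
    using simplex_aff_dim_face_less[OF S(1)[OF that(2)]] aff_dim_simplex[OF S(1)[OF that(1)]] that(3) by (metis less_irrefl)
  have inj: "inj_on ball S"
  proof (rule inj_onI)
    fix \<delta> \<epsilon> assume "\<delta> \<in> S" "\<epsilon> \<in> S" "ball \<delta> = ball \<epsilon>"
    then show "\<delta> = \<epsilon>" using inj_onD[OF barycenter_inj[OF K]] S by (auto simp: ball_def)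
  qed
  have proper: "C \<in> flags (proper_faces \<delta>)" if "C \<in> flags {\<tau>. \<tau> face_of \<delta>}" "\<delta> \<notin> C" for C \<delta>
    using that by (auto simp: flags_def proper_faces_def)
  have bs: "ball_simplices D (fst (ball \<delta>)) (snd (ball \<delta>))
      = flag_simplex ` {C \<in> flags {\<tau>. \<tau> face_of \<delta>}. card C = Suc D \<and> \<delta> \<in> C}"
    and bc: "ball_complex D (fst (ball \<delta>)) (snd (ball \<delta>)) = subdivision {\<tau>. \<tau> face_of \<delta>}" if "\<delta> \<in> S" for \<delta>
    using ball_simplices_flags[OF S(1)[OF that]] ball_complex_flags[OF S(1)[OF that]] by (simp_all add: ball_def)
  \<comment> \<open>A shared top simplex comes from a single flag, which would contain
    \<open>\<delta>\<close> and consist of faces of \<open>\<epsilon>\<close>; equal dimensions rule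
    this out.\<close>
  have disj: "ball_simplices D (fst (ball \<delta>)) (snd (ball \<delta>)) \<inter> ball_simplices D (fst (ball \<epsilon>)) (snd (ball \<epsilon>)) = {}"
    if de: "\<delta> \<in> S" "\<epsilon> \<in> S" "\<delta> \<noteq> \<epsilon>" for \<delta> \<epsilon>
  proof (rule ccontr)
    assume "\<not> ?thesis"
    then obtain B C where BC: "B \<in> flags {\<tau>. \<tau> face_of \<delta>}" "\<delta> \<in> B" "C \<in> flags {\<tau>. \<tau> face_of \<epsilon>}"
        "flag_simplex B = flag_simplex C"
      unfolding bs[OF de(1)] bs[OF de(2)] by auto
    have "B = C"
      using inj_onD[OF flag_simplex_inj[OF K] BC(4)] flagsK BC de by blast
    then have "\<delta> face_of \<epsilon>" using BC by (auto simp: flags_def)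
    then show False using noface de by blast
  qed
  \<comment> \<open>The flag of a shared simplex contains neither \<open>\<delta>\<close> nor
    \<open>\<epsilon>\<close>, for the same dimension reason, so it lies in both boundaries.\<close>
  have inter: "ball_complex D (fst (ball \<delta>)) (snd (ball \<delta>)) \<inter> ball_complex D (fst (ball \<epsilon>)) (snd (ball \<epsilon>))
      \<subseteq> snd (ball \<delta>) \<inter> snd (ball \<epsilon>)"
    if de: "\<delta> \<in> S" "\<epsilon> \<in> S" "\<delta> \<noteq> \<epsilon>" for \<delta> \<epsilon>
  proof
    fix x assume "x \<in> ball_complex D (fst (ball \<delta>)) (snd (ball \<delta>)) \<inter> ball_complex D (fst (ball \<epsilon>)) (snd (ball \<epsilon>))"
    then obtain B C where BC: "B \<in> flags {\<tau>. \<tau> face_of \<delta>}" "C \<in> flags {\<tau>. \<tau> face_of \<epsilon>}"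
        "x = flag_simplex B" "flag_simplex B = flag_simplex C"
      unfolding bc[OF de(1)] bc[OF de(2)] subdivision_def by auto
    have e: "B = C"
      using inj_onD[OF flag_simplex_inj[OF K] BC(4)] flagsK BC de by blast
    have "\<delta> \<notin> B" "\<epsilon> \<notin> B" using BC e noface de by (auto simp: flags_def)
    then show "x \<in> snd (ball \<delta>) \<inter> snd (ball \<epsilon>)"
      using proper BC e by (auto simp: ball_def subdivision_def)
  qed
  have un: "subdivision K = (\<Union>(v, Y)\<in>ball ` S. ball_complex D v Y)"
  proof -
    have "(\<Union>(v, Y)\<in>ball ` S. ball_complex D v Y) = (\<Union>\<delta>\<in>S. subdivision {\<tau>. \<tau> face_of \<delta>})"
      using bc by (auto simp: case_prod_beta)
    then show ?thesis unfolding subdivision_def pseudomanifold_flags[OF P] S_def by (simp add: image_UN)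
  qed
  \<comment> \<open>The flag of \<open>\<rho>\<close> has \<open>D\<close> members below
    \<open>\<delta>\<close>, so its top \<open>\<tau>\<close> has dimension exactly
    \<open>D - 1\<close>. The balls with \<open>\<rho>\<close> in their boundary are those of the
    \<open>D\<close>-simplices containing \<open>\<tau>\<close>, of which there are two.\<close>
  have ridge: "card {(w, Z) \<in> ball ` S. \<rho> \<in> Z} = 2"
    if "D \<ge> 1" and d: "\<delta> \<in> S" and r: "\<rho> \<in> simplices (int D - 1) (snd (ball \<delta>))" for \<delta> \<rho>
  proof -
    note Kp = simplicial_complex_proper_faces[OF S(1)[OF d]]
    obtain C where C: "C \<in> flags (proper_faces \<delta>)" "\<rho> = flag_simplex C"
      using r by (auto simp: simplices_def ball_def subdivision_def)
    have cC: "card C = D" using r flag_simplex_simplex[OF Kp C(1)] C(2) by (simp add: simplices_def)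
    then have "C \<noteq> {}" using \<open>D \<ge> 1\<close> by auto
    then obtain \<tau> where t: "\<tau> \<in> C" "\<tau> \<in> proper_faces \<delta>" "C - {\<tau>} \<in> flags (proper_faces \<tau>)"
      using flag_top[OF Kp C(1)] by metis
    obtain n where n: "n simplex \<tau>" using Kp t(2) unfolding simplicial_complex_def by blast
    have "int D \<le> n + 1" using card_flag_le_top[OF Kp C(1) t(1,3) n] cC by simp
    moreover have "n < int D"
      using simplex_aff_dim_face_less[OF S(1)[OF d], of \<tau>] t(2) aff_dim_simplex[OF n] by (simp add: proper_faces_def)
    ultimately have n_eq: "n = int D - 1" by simp
    have tK: "\<tau> \<in> K" using t(2) faces[OF d] by (auto simp: proper_faces_def)
    have mem: "\<rho> \<in> snd (ball \<epsilon>) \<longleftrightarrow> \<tau> \<subseteq> \<epsilon>" if e: "\<epsilon> \<in> S" for \<epsilon>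
    proof
      assume "\<rho> \<in> snd (ball \<epsilon>)"
      then obtain B where B: "B \<in> flags (proper_faces \<epsilon>)" "flag_simplex C = flag_simplex B"
        using C by (auto simp: ball_def subdivision_def)
      have "C = B" using inj_onD[OF flag_simplex_inj[OF K] B(2)] bflagsK C B d e by blast
      then show "\<tau> \<subseteq> \<epsilon>" using t B by (auto simp: flags_def proper_faces_def dest: face_of_imp_subset)
    next
      assume "\<tau> \<subseteq> \<epsilon>"
      then have f: "\<tau> face_of \<epsilon>" using simplicial_complex_face[OF K tK S(2)[OF e]] by blast
      have "\<tau> \<noteq> \<epsilon>" using aff_dim_simplex[OF n] aff_dim_simplex[OF S(1)[OF e]] n_eq by auto
      then have te: "\<tau> \<in> proper_faces \<epsilon>" using f by (simp add: proper_faces_def)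
      have "C \<subseteq> proper_faces \<epsilon>"
      proof
        fix \<upsilon> assume u: "\<upsilon> \<in> C"
        show "\<upsilon> \<in> proper_faces \<epsilon>"
        proof (cases "\<upsilon> = \<tau>")
          case False
          then have "\<upsilon> face_of \<tau>" using u t(3) by (auto simp: flags_def proper_faces_def)
          then show ?thesis
            using te simplicial_complex_proper_faces[OF S(1)[OF e]] unfolding simplicial_complex_def by blast
        qed (use te in simp)
      qed
      then show "\<rho> \<in> snd (ball \<epsilon>)"
        using flags_mono[OF C(1)] C(2) by (simp add: ball_def subdivision_def)
    qed
    have "{(w, Z) \<in> ball ` S. \<rho> \<in> Z} = ball ` {\<epsilon> \<in> S. \<rho> \<in> snd (ball \<epsilon>)}"
      unfolding case_prod_beta prod.collapse by blast
    also have "{\<epsilon> \<in> S. \<rho> \<in> snd (ball \<epsilon>)} = {\<epsilon> \<in> S. \<tau> \<subseteq> \<epsilon>}" using mem by blast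
    finally have "{(w, Z) \<in> ball ` S. \<rho> \<in> Z} = ball ` {\<epsilon> \<in> S. \<tau> \<subseteq> \<epsilon>}" .
    moreover have "card {\<epsilon> \<in> S. \<tau> \<subseteq> \<epsilon>} = 2"
      using P \<open>D \<ge> 1\<close> tK n unfolding pseudomanifold_complex_def S_def n_eq simplices_def by blast
    ultimately show ?thesis
      using card_image[OF inj_on_subset[OF inj, of "{\<epsilon> \<in> S. \<tau> \<subseteq> \<epsilon>}"]] by simp
  qed
  \<comment> \<open>The ends of an edge are barycenters of two nested distinct simplices, whose
    dimensions differ.\<close>
  have col: "proper_coloring D (subdivision K) c"
    unfolding proper_coloring_def complex_vertices_subdivision[OF K]
  proof (intro conjI ballI impI)
    have "aff_dim \<sigma> \<le> int D" if "\<sigma> \<in> K" for \<sigma>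
    proof -
      obtain \<delta> where "\<delta> \<in> S" "\<sigma> \<subseteq> \<delta>" using pure \<open>\<sigma> \<in> K\<close> by blast
      then show ?thesis using aff_dim_subset[of \<sigma> \<delta>] aff_dim_simplex[OF S(1)] by simp
    qed
    then have "c (barycenter \<sigma>) \<le> D" if "\<sigma> \<in> K - {{}}" for \<sigma>
      using c[OF that] that nat_mono[of "aff_dim \<sigma>" "int D"] by simp
    then show "c ` barycenter ` (K - {{}}) \<subseteq> {0..D}"
      unfolding image_subset_iff atLeastAtMost_iff by blast
    fix e u w assume e: "e \<in> simplices 1 (subdivision K)" and uw: "u \<in> verts e" "w \<in> verts e" "u \<noteq> w"
    obtain C where C: "C \<in> flags K" "e = flag_simplex C" using e by (auto simp: simplices_def subdivision_def)
    obtain \<sigma> \<tau> where st: "\<sigma> \<in> C" "\<tau> \<in> C" "u = barycenter \<sigma>" "w = barycenter \<tau>"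
      using uw unfolding C(2) verts_flag_simplex[OF K C(1)] by blast
    have K': "\<sigma> \<in> K - {{}}" "\<tau> \<in> K - {{}}" using st C(1) by (auto simp: flags_def)
    have less: "nat (aff_dim \<alpha>) < nat (aff_dim \<beta>)" if "\<alpha> \<subset> \<beta>" "\<alpha> \<in> K - {{}}" "\<beta> \<in> K - {{}}" for \<alpha> \<beta>
    proof -
      have "\<alpha> face_of \<beta>" using simplicial_complex_face[OF K] that by blast
      moreover have "convex \<beta>" using K that convex_simplex unfolding simplicial_complex_def by blast
      ultimately have "aff_dim \<alpha> < aff_dim \<beta>" using face_of_aff_dim_lt that by blast
      moreover have "0 \<le> aff_dim \<alpha>" using that(2) aff_dim_negative_iff[of \<alpha>] by (simp add: not_less[symmetric])
      ultimately show ?thesis by simp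
    qed
    have "\<sigma> \<subset> \<tau> \<or> \<tau> \<subset> \<sigma>"
      using C(1) st uw(3) unfolding flags_def chain_subset_def by blast
    then show "c u \<noteq> c w" using less K' st c by (metis less_irrefl)
  qed
  show ?thesis
    unfolding ballset colex.simps
  proof (intro conjI impI)
    show "simplicial_complex (subdivision K)" using simplicial_complex_subdivision K .
    show "finite (ball ` S)" using finS by simp
    show "\<forall>(v, Y)\<in>ball ` S. colorable_ball D v Y" using balls by (auto simp: ball_def S_def)
    show "subdivision K = (\<Union>(v, Y)\<in>ball ` S. ball_complex D v Y)" by (rule un)
    have "(fst (ball \<delta>), snd (ball \<delta>)) \<noteq> (fst (ball \<epsilon>), snd (ball \<epsilon>)) \<longrightarrow>
       ball_simplices D (fst (ball \<delta>)) (snd (ball \<delta>)) \<inter> ball_simplices D (fst (ball \<epsilon>)) (snd (ball \<epsilon>)) = {} \<and>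
       ball_complex D (fst (ball \<delta>)) (snd (ball \<delta>)) \<inter> ball_complex D (fst (ball \<epsilon>)) (snd (ball \<epsilon>))
         \<subseteq> snd (ball \<delta>) \<inter> snd (ball \<epsilon>)" if "\<delta> \<in> S" "\<epsilon> \<in> S" for \<delta> \<epsilon>
      using disj[OF that] inter[OF that] by blast
    then show "\<forall>(v, Y)\<in>ball ` S. \<forall>(w, Z)\<in>ball ` S. (v, Y) \<noteq> (w, Z) \<longrightarrow>
        ball_simplices D v Y \<inter> ball_simplices D w Z = {} \<and>
        ball_complex D v Y \<inter> ball_complex D w Z \<subseteq> Y \<inter> Z"
      unfolding case_prod_beta by blast
    show "\<forall>(v, Y)\<in>ball ` S. \<forall>\<tau>\<in>simplices (int D - 1) Y. card {(w, Z) \<in> ball ` S. \<tau> \<in> Z} = 2" if "D \<ge> 1"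
      unfolding case_prod_beta using ridge[OF that, unfolded case_prod_beta] by blast
    show "proper_coloring D (subdivision K) c" by (rule col)
  qed
qed

text \<open>Dimension is a well-defined function of the barycenter, because the barycenter
  determines its simplex.\<close>

lemma barycenter_coloring:
  assumes "simplicial_complex K"
  obtains c where "\<And>\<sigma>. \<sigma> \<in> K - {{}} \<Longrightarrow> c (barycenter \<sigma>) = nat (aff_dim \<sigma>)"
  using that[of "\<lambda>x. nat (aff_dim (the_inv_into (K - {{}}) barycenter x))"]
    the_inv_into_f_f[OF barycenter_inj[OF assms]] by simp

text \<open>Induction on dimension: the boundary is again a pseudomanifold, its balls are colorable
  by the induction hypothesis, and its underlying space is the relative frontier, a sphere.\<close>

lemma colorable_ball_subdivision:
  assumes "int D simplex \<delta>"
  shows "colorable_ball D (barycenter \<delta>) (subdivision (proper_faces \<delta>))"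
  using assms
proof (induction D arbitrary: \<delta>)
  case 0
  then show ?case using sd_simplex_boundary_eq_subdivision[OF 0] by simp
next
  case (Suc n)
  note s = Suc.prems
  have K: "simplicial_complex (proper_faces \<delta>)" "simplicial_complex {\<tau>. \<tau> face_of \<delta>}"
    using simplicial_complex_proper_faces simplicial_complex_faces s by blast+
  have b: "barycenter \<delta> \<in> rel_interior \<delta>" using barycenter_in_rel_interior[OF s] s by (cases "\<delta> = {}") simp_all
  have un: "\<Union>(subdivision (proper_faces \<delta>)) = rel_frontier \<delta>"
    unfolding Union_subdivision[OF K(1)] rel_frontier_of_polyhedron_alt[OF simplex_imp_polyhedron[OF s]]
    by (simp add: proper_faces_def)
  show ?case
    unfolding colorable_ball.simps
  proof (intro conjI)
    obtain c where c: "\<And>\<sigma>. \<sigma> \<in> proper_faces \<delta> - {{}} \<Longrightarrow> c (barycenter \<sigma>) = nat (aff_dim \<sigma>)"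
      using barycenter_coloring[OF K(1)] by metis
    have "colex n (subdivision (proper_faces \<delta>))
       {(barycenter \<epsilon>, subdivision (proper_faces \<epsilon>)) | \<epsilon>. \<epsilon> \<in> simplices (int n) (proper_faces \<delta>)} c"
      using Suc.IH by (intro colex_subdivision_if_balls[OF pseudomanifold_proper_faces[OF s] c])
        (auto simp: simplices_def)
    then show "\<exists>P c. colex n (subdivision (proper_faces \<delta>)) P c" by blast
    show "top_of_set (\<Union>(subdivision (proper_faces \<delta>))) homeomorphic_space nsphere n"
      unfolding un by (rule simplex_rel_frontier_homeomorphic_nsphere[OF s])
    have "barycenter \<delta> \<notin> \<Union>(subdivision (proper_faces \<delta>))" unfolding un using b by (simp add: rel_frontier_def)
    then show "barycenter \<delta> \<notin> complex_vertices (subdivision (proper_faces \<delta>))"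
      by (auto simp: complex_vertices_def)
    show "\<forall>\<sigma>\<in>ball_simplices (Suc n) (barycenter \<delta>) (subdivision (proper_faces \<delta>)). int (Suc n) simplex \<sigma>"
      unfolding ball_simplices_flags[OF s] using flag_simplex_simplex[OF K(2)] by auto
    show "simplicial_complex (ball_complex (Suc n) (barycenter \<delta>) (subdivision (proper_faces \<delta>)))"
      unfolding ball_complex_flags[OF s] by (rule simplicial_complex_subdivision[OF K(2)])
  qed
qed

text \<open>The combinatorial half of the argument: topology enters only through the spheres
  bounding the balls.\<close>

lemma pseudomanifold_subdivision_colex:
  assumes P: "pseudomanifold_complex D X"
  shows "complex_vertices (barycentric_subdivision D X)
           = {barycenter \<sigma> | \<sigma> i. i \<le> D \<and> \<sigma> \<in> simplices (int i) X} \<and>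
         (\<exists>c. (\<forall>i\<le>D. \<forall>\<sigma>\<in>simplices (int i) X. c (barycenter \<sigma>) = i) \<and>
              colex D (barycentric_subdivision D X)
                {(barycenter \<delta>, sd_boundary D \<delta>) | \<delta>. \<delta> \<in> simplices (int D) X} c)"
proof -
  have K: "simplicial_complex X" using P by (simp add: pseudomanifold_complex_def)
  have sd: "sd_simplex D \<delta> = subdivision {\<tau>. \<tau> face_of \<delta>}" "sd_boundary D \<delta> = subdivision (proper_faces \<delta>)"
    if "\<delta> \<in> simplices (int D) X" for \<delta>
    using sd_simplex_boundary_eq_subdivision[of D \<delta>] that by (auto simp: simplices_def)
  have sub: "barycentric_subdivision D X = subdivision X"
    unfolding barycentric_subdivision_def subdivision_def pseudomanifold_flags[OF P]
    by (simp add: sd subdivision_def image_UN)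
  have balls: "{(barycenter \<delta>, sd_boundary D \<delta>) | \<delta>. \<delta> \<in> simplices (int D) X}
      = {(barycenter \<delta>, subdivision (proper_faces \<delta>)) | \<delta>. \<delta> \<in> simplices (int D) X}"
    using sd(2) by auto
  obtain c where c: "\<And>\<sigma>. \<sigma> \<in> X - {{}} \<Longrightarrow> c (barycenter \<sigma>) = nat (aff_dim \<sigma>)"
    using barycenter_coloring[OF K] by metis
  have dim: "\<exists>i\<le>D. \<sigma> \<in> simplices (int i) X" if s: "\<sigma> \<in> X" "\<sigma> \<noteq> {}" for \<sigma>
  proof -
    obtain n where n: "n simplex \<sigma>" using K s unfolding simplicial_complex_def by blast
    obtain \<delta> where "\<delta> \<in> simplices (int D) X" "\<sigma> \<subseteq> \<delta>" using P s unfolding pseudomanifold_complex_def by blast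
    then have "n \<le> int D"
      using aff_dim_simplex[OF n] aff_dim_subset[of \<sigma> \<delta>] aff_dim_simplex[of "int D" \<delta>] by (simp add: simplices_def)
    moreover have "0 \<le> n" using aff_dim_simplex[OF n] s aff_dim_negative_iff[of \<sigma>] by linarith
    ultimately show ?thesis using n s by (intro exI[of _ "nat n"]) (simp add: simplices_def)
  qed
  have "barycenter ` (X - {{}}) = {barycenter \<sigma> | \<sigma> i. i \<le> D \<and> \<sigma> \<in> simplices (int i) X}"
    using dim by (fastforce simp: simplices_def)
  moreover have "c (barycenter \<sigma>) = i" if "\<sigma> \<in> simplices (int i) X" for \<sigma> i
  proof -
    have "int i simplex \<sigma>" "\<sigma> \<in> X - {{}}" using that by (auto simp: simplices_def)
    then show ?thesis using c aff_dim_simplex by (metis nat_int)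
  qed
  moreover have "colex D (subdivision X)
      {(barycenter \<delta>, subdivision (proper_faces \<delta>)) | \<delta>. \<delta> \<in> simplices (int D) X} c"
    using colorable_ball_subdivision by (intro colex_subdivision_if_balls[OF P c]) (auto simp: simplices_def)
  ultimately show ?thesis
    unfolding sub balls complex_vertices_subdivision[OF K] by blast
qed

section \<open>Triangulated manifolds are pseudomanifolds\<close>

text \<open>Deleting the finitely many closed simplices that do not contain \<open>\<sigma>\<close>
  leaves an open set, and \<open>x\<close> survives since any simplex through a relative interior
  point of \<open>\<sigma>\<close> contains \<open>\<sigma>\<close>.\<close>

lemma open_star:
  assumes K: "simplicial_complex K" and s: "\<sigma> \<in> K" and x: "x \<in> rel_interior \<sigma>"
  obtains N where "openin (top_of_set (\<Union>K)) N" "x \<in> N" "N \<subseteq> \<Union>{\<tau> \<in> K. \<sigma> \<subseteq> \<tau>}"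
proof
  define N where "N = \<Union>K - \<Union>{\<tau> \<in> K. \<not> \<sigma> \<subseteq> \<tau>}"
  have "closed \<tau>" if "\<tau> \<in> K" for \<tau>
    using K that closed_simplex unfolding simplicial_complex_def by blast
  moreover have "finite {\<tau> \<in> K. \<not> \<sigma> \<subseteq> \<tau>}" using K unfolding simplicial_complex_def by simp
  ultimately have "closed (\<Union>{\<tau> \<in> K. \<not> \<sigma> \<subseteq> \<tau>})" by (intro closed_Union) auto
  then show "openin (top_of_set (\<Union>K)) N"
    unfolding N_def by (metis Diff_eq open_Compl openin_open_Int)
  show "x \<in> N"
    using rel_interior_meets_simplex[OF K s _ x] s x rel_interior_subset unfolding N_def by blast
  show "N \<subseteq> \<Union>{\<tau> \<in> K. \<sigma> \<subseteq> \<tau>}" unfolding N_def by blast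
qed

lemma simplex_rel_interior_nonempty:
  assumes "n simplex \<sigma>" "\<sigma> \<noteq> {}"
  obtains x where "x \<in> rel_interior \<sigma>"
  using barycenter_in_rel_interior assms by blast

text \<open>Around a relative interior point of a maximal simplex \<open>\<delta>\<close> the
  complex consists of \<open>\<delta>\<close> alone. A nonempty open part of it thus lies in the
  affine hull of \<open>\<delta>\<close>, whose dimension must be at least \<open>D\<close>.\<close>

lemma charts_imp_pure:
  assumes K: "dimensional_complex D K" and T: "euclidean_charts D (\<Union>K)" and s: "\<sigma> \<in> K"
  shows "\<exists>\<delta>\<in>simplices (int D) K. \<sigma> \<subseteq> \<delta>"
proof -
  have sc: "simplicial_complex K" using K by (simp add: dimensional_complex_def)
  obtain \<delta> where d: "\<delta> \<in> K" "\<sigma> \<subseteq> \<delta>" "\<And>\<tau>. \<tau> \<in> K \<Longrightarrow> \<delta> \<subseteq> \<tau> \<Longrightarrow> \<delta> = \<tau>"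
    using finite_has_maximal2[of K \<sigma>] s sc unfolding simplicial_complex_def by metis
  obtain n where n: "n simplex \<delta>" using sc d(1) unfolding simplicial_complex_def by blast
  have "\<delta> \<noteq> {}"
  proof
    assume e: "\<delta> = {}"
    obtain \<epsilon> where "\<epsilon> \<in> simplices (int D) K" using K unfolding dimensional_complex_def by blast
    then show False using d(3)[of \<epsilon>] e by (auto simp: simplices_def)
  qed
  then obtain x where x: "x \<in> rel_interior \<delta>" using simplex_rel_interior_nonempty n by metis
  obtain N where N: "openin (top_of_set (\<Union>K)) N" "x \<in> N" "N \<subseteq> \<Union>{\<tau> \<in> K. \<delta> \<subseteq> \<tau>}"
    using open_star[OF sc d(1) x] by metis
  have "N \<subseteq> affine hull \<delta>" using N(3) d(3) hull_subset[of \<delta> affine] by blast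
  then have "int D \<le> aff_dim \<delta>"
    using charts_open_in_affine(1)[OF T affine_affine_hull _ N(1)] N(2) by auto
  then have "n = int D" using K d(1) aff_dim_simplex[OF n] unfolding dimensional_complex_def by force
  then show ?thesis using n d by (auto simp: simplices_def)
qed

text \<open>The point is the convex combination of \<open>v\<close>, with weight \<open>t\<close>,
  and \<open>x + s / (1 - t)\<close>. As \<open>t < 1/2\<close> the displacement at most doubles, so
  half the radius \<open>r\<close> suffices, uniformly in \<open>C\<close> and
  \<open>v\<close>.\<close>

lemma rel_interior_cone:
  fixes F :: "'a::euclidean_space set"
  assumes x: "x \<in> rel_interior F"
  obtains e where "e > 0"
    "\<And>s t v C. \<lbrakk>x + s \<in> affine hull F; norm s < e; 0 \<le> t; t < 1/2; convex C; F \<subseteq> C; v \<in> C\<rbrakk>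
       \<Longrightarrow> x + s + t *\<^sub>R (v - x) \<in> C"
proof -
  obtain r where r: "r > 0" "ball x r \<inter> affine hull F \<subseteq> F"
    using x by (auto simp: mem_rel_interior_ball)
  have "x + s + t *\<^sub>R (v - x) \<in> C"
    if "x + s \<in> affine hull F" "norm s < r / 2" "0 \<le> t" "t < 1/2" "convex C" "F \<subseteq> C" "v \<in> C" for s t v C
  proof -
    define c where "c = 1 / (1 - t)"
    have c: "0 < c" "c \<le> 2" "(1 - t) * c = 1" using that by (auto simp: c_def field_simps)
    have "x \<in> affine hull F" using x rel_interior_subset hull_subset[of F affine] by blast
    then have "(1 - c) *\<^sub>R x + c *\<^sub>R (x + s) \<in> affine hull F"
      using that(1) by (intro mem_affine) auto
    then have "x + c *\<^sub>R s \<in> affine hull F" by (simp add: algebra_simps)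
    moreover have "norm (c *\<^sub>R s) < r"
    proof -
      have "norm (c *\<^sub>R s) \<le> 2 * norm s" using c by (simp add: mult_right_mono)
      then show ?thesis using that(2) by simp
    qed
    moreover from this have "x + c *\<^sub>R s \<in> ball x r" by (simp add: dist_norm)
    ultimately have "x + c *\<^sub>R s \<in> C" using r(2) that(6) by blast
    then have "(1 - t) *\<^sub>R (x + c *\<^sub>R s) + t *\<^sub>R v \<in> C"
      using that by (intro convexD) auto
    moreover have "(1 - t) *\<^sub>R (x + c *\<^sub>R s) + t *\<^sub>R v = x + s + t *\<^sub>R (v - x)"
      by (simp only: scaleR_add_right scaleR_scaleR c(3)) (simp add: algebra_simps)
    ultimately show ?thesis by simp
  qed
  then show thesis using that[of "r / 2"] r(1) by auto
qed

text \<open>The intersection is a proper face of \<open>\<delta>\<close>, hence of dimension below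
  \<open>D\<close>; if it properly contained \<open>F\<close>, its dimension would exceed
  \<open>D - 1\<close>.\<close>

lemma simplices_sharing_ridge_Int:
  assumes K: "simplicial_complex K" and F: "F \<in> simplices (int D - 1) K"
    and d: "\<delta> \<in> simplices (int D) K" "\<epsilon> \<in> simplices (int D) K" "F \<subseteq> \<delta>" "F \<subseteq> \<epsilon>" "\<delta> \<noteq> \<epsilon>"
  shows "\<delta> \<inter> \<epsilon> = F"
proof (rule ccontr)
  assume ne: "\<delta> \<inter> \<epsilon> \<noteq> F"
  have dK: "\<delta> \<in> K" "\<epsilon> \<in> K" "F \<in> K" "int D simplex \<delta>" "int D simplex \<epsilon>" "int D - 1 simplex F"
    using d F by (auto simp: simplices_def)
  have f: "\<delta> \<inter> \<epsilon> face_of \<delta>" using K dK unfolding simplicial_complex_def by blast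
  have "\<delta> \<inter> \<epsilon> \<noteq> \<delta>"
  proof
    assume "\<delta> \<inter> \<epsilon> = \<delta>"
    then have "\<delta> face_of \<epsilon>" using simplicial_complex_face[OF K dK(1,2)] by blast
    then show False using simplex_aff_dim_face_less[OF dK(5)] d(5) aff_dim_simplex[OF dK(4)] by (metis less_irrefl)
  qed
  then have "aff_dim (\<delta> \<inter> \<epsilon>) < int D" using simplex_aff_dim_face_less[OF dK(4) f] by blast
  moreover have "\<delta> \<inter> \<epsilon> \<in> K" using K f dK unfolding simplicial_complex_def by blast
  then have "F face_of \<delta> \<inter> \<epsilon>" using simplicial_complex_face[OF K dK(3)] d by blast
  then have "aff_dim F < aff_dim (\<delta> \<inter> \<epsilon>)"
    using face_of_aff_dim_lt[of "\<delta> \<inter> \<epsilon>" F] ne convex_simplex[OF dK(4)] convex_simplex[OF dK(5)]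
    by (metis convex_Int)
  ultimately show False using aff_dim_simplex[OF dK(6)] by simp
qed

text \<open>Two of the three sets fill a neighbourhood of \<open>x\<close> in \<open>T\<close> by
  invariance of domain. Points of the third set close to \<open>x\<close> then lie in the first two,
  hence in \<open>F\<close>, although some of them are off the affine hull of
  \<open>F\<close>.\<close>

lemma charts_at_most_two:
  fixes T :: "'a::euclidean_space set"
  assumes T: "euclidean_charts D T" and D: "D \<ge> 1"
    and F: "int D - 1 simplex F" and x: "x \<in> rel_interior F"
    and C: "\<And>i::nat. i < 3 \<Longrightarrow> convex (C i) \<and> F \<subseteq> C i \<and> C i \<subseteq> T \<and> aff_dim (C i) = int D"
    and CF: "\<And>i j. i < 3 \<Longrightarrow> j < 3 \<Longrightarrow> i \<noteq> j \<Longrightarrow> C i \<inter> C j = F"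
  shows False
proof -
  \<comment> \<open>The direction space of the affine hull of \<open>F\<close>, of dimension
    \<open>D - 1\<close>. Each \<open>C i\<close> has dimension \<open>D\<close>, so it contains a
    point \<open>v i\<close> whose direction from \<open>x\<close> is transverse to
    \<open>S\<close>.\<close>
  define S where "S = (\<lambda>y. y - x) ` (affine hull F)"
  have xF: "x \<in> F" "x \<in> affine hull F" using x rel_interior_subset hull_subset[of F affine] by blast+
  have S: "subspace S"
    unfolding S_def using affine_diffs_subspace_subtract[OF affine_affine_hull xF(2)] by simp
  have memS: "s \<in> S \<longleftrightarrow> x + s \<in> affine hull F" for s unfolding S_def by (force simp: image_iff)
  have dimS: "int (dim S) = int D - 1"
    using aff_dim_eq_dim_subtract[of x "affine hull F"] aff_dim_simplex[OF F] xF(2)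
    by (simp add: S_def aff_dim_affine_hull)
  have "\<exists>v. v \<in> C i \<and> v - x \<notin> S" if "i < 3" for i
  proof (rule ccontr)
    assume "\<nexists>v. v \<in> C i \<and> v - x \<notin> S"
    then have "C i \<subseteq> affine hull F" using memS by auto
    then have "aff_dim (C i) \<le> aff_dim F" by (metis aff_dim_affine_hull aff_dim_subset)
    then show False using C[OF that] aff_dim_simplex[OF F] by simp
  qed
  then obtain v where v: "\<And>i. i < 3 \<Longrightarrow> v i \<in> C i \<and> v i - x \<notin> S" by metis
  have out: "w \<in> S" if "s \<in> S" "s + t *\<^sub>R w \<in> S" "t \<noteq> 0" for s w and t :: real
  proof -
    have "(1 / t) *\<^sub>R (s + t *\<^sub>R w - s) \<in> S" using S that subspace_diff subspace_scale by blast
    then show ?thesis using that(3) by simp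
  qed
  obtain e where e: "e > 0"
    "\<And>s t v C. \<lbrakk>x + s \<in> affine hull F; norm s < e; 0 \<le> t; t < 1/2; convex C; F \<subseteq> C; v \<in> C\<rbrakk>
       \<Longrightarrow> x + s + t *\<^sub>R (v - x) \<in> C"
    using rel_interior_cone[OF x] by metis
  have cone: "x + s + t *\<^sub>R (v i - x) \<in> C i" if "s \<in> S" "norm s < e" "0 \<le> t" "t < 1/2" "i < 3" for s t i
    using e(2)[of s t "C i" "v i"] C[OF that(5)] v[OF that(5)] that memS by blast
  \<comment> \<open>Bends a flat \<open>D\<close>-dimensional neighbourhood of \<open>x\<close> along \<open>F\<close>, one half into \<open>C 0\<close> and the other into \<open>C 1\<close>.\<close>
  define \<phi> where "\<phi> p = x + fst p + max (snd p) 0 *\<^sub>R (v 0 - x) + max (- snd p) 0 *\<^sub>R (v 1 - x)" for p :: "'a \<times> real"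
  \<comment> \<open>The flat model has the \<open>D - 1\<close> directions along \<open>F\<close>
    and one real coordinate across it. The bounds \<open>e\<close> and \<open>1/2\<close> in
    \<open>N\<close> are those under which \<open>cone\<close> keeps the bent points inside
    \<open>C 0\<close> and \<open>C 1\<close>.\<close>
  define A where "A = S \<times> (UNIV :: real set)"
  define N where "N = A \<inter> (ball 0 e \<times> {-1/2<..<1/2})"
  have A: "affine A" "aff_dim A = int D"
    using S dimS by (simp_all add: A_def subspace_Times subspace_imp_affine aff_dim_subspace dim_Times)
  have N: "openin (top_of_set A) N"
    unfolding N_def by (intro openin_open_Int open_Times) auto
  have Np: "fst p \<in> S" "norm (fst p) < e" "\<bar>snd p\<bar> < 1/2" if "p \<in> N" for p
    using that by (auto simp: N_def A_def)
  have pos: "\<phi> p \<in> C 0" "\<phi> p = x + fst p + snd p *\<^sub>R (v 0 - x)" if "p \<in> N" "snd p \<ge> 0" for p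
    using cone[of "fst p" "snd p" 0] Np[OF that(1)] that(2) by (simp_all add: \<phi>_def)
  have neg: "\<phi> p \<in> C 1" "\<phi> p = x + fst p + (- snd p) *\<^sub>R (v 1 - x)" if "p \<in> N" "snd p \<le> 0" for p
    using cone[of "fst p" "- snd p" 1] Np[OF that(1)] that(2) by (simp_all add: \<phi>_def)
  have "\<phi> p \<in> C 0 \<union> C 1" if "p \<in> N" for p using pos neg that by (meson UnI1 UnI2 linear)
  then have sub: "\<phi> ` N \<subseteq> C 0 \<union> C 1" by (rule image_subsetI)
  \<comment> \<open>A collision between the two sides would lie in
    \<open>C 0 \<inter> C 1 = F\<close>, but a strictly positive last coordinate pushes the point
    off the affine hull of \<open>F\<close>.\<close>
  have opp: False if pq: "p \<in> N" "q \<in> N" "snd p > 0" "snd q \<le> 0" "\<phi> p = \<phi> q" for p q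
  proof -
    have "\<phi> p \<in> C 0 \<inter> C 1" using pos[of p] neg[of q] pq by simp
    also have "C 0 \<inter> C 1 = F" using CF[of 0 1] by simp
    finally have "\<phi> p \<in> affine hull F" using hull_subset[of F affine] by blast
    then have "fst p + snd p *\<^sub>R (v 0 - x) \<in> S" using pos[of p] pq by (simp add: memS add.assoc)
    then show False using out[of "fst p" "snd p" "v 0 - x"] Np[OF pq(1)] pq(3) v[of 0] by simp
  qed
  have same: "s = s' \<and> t = t'" if st: "s \<in> S" "s' \<in> S" "x + s + t *\<^sub>R w = x + s' + t' *\<^sub>R w" "w \<notin> S"
    for s s' w and t t' :: real
  proof -
    have eq: "s + (t - t') *\<^sub>R w = s'" using st(3) by (simp add: algebra_simps)
    then have "t = t'" using out[of s "t - t'" w] st by auto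
    then show ?thesis using eq by simp
  qed
  have inj: "inj_on \<phi> N"
  proof (rule inj_onI)
    fix p q assume pq: "p \<in> N" "q \<in> N" "\<phi> p = \<phi> q"
    consider "snd p > 0" "snd q > 0" | "snd p \<le> 0" "snd q \<le> 0"
      using opp[of p q] opp[of q p] pq by fastforce
    then show "p = q"
    proof cases
      case 1
      then show ?thesis
        using same[of "fst p" "fst q" "snd p" "v 0 - x" "snd q"] pos[of p] pos[of q] pq Np v[of 0]
        by (simp add: prod_eq_iff)
    next
      case 2
      then show ?thesis
        using same[of "fst p" "fst q" "- snd p" "v 1 - x" "- snd q"] neg[of p] neg[of q] pq Np v[of 1]
        by (simp add: prod_eq_iff)
    qed
  qed
  have "continuous_on N \<phi>" unfolding \<phi>_def by (intro continuous_intros)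
  moreover have "C 0 \<union> C 1 \<subseteq> T" using C[of 0] C[of 1] by simp
  then have "\<phi> ` N \<subseteq> T" by (rule subset_trans[OF sub])
  ultimately have op: "openin (top_of_set T) (\<phi> ` N)"
    using invariance_of_domain_charts[OF T A N _ _ inj] by blast
  have "(0, 0) \<in> N" using e(1) S by (simp add: N_def A_def subspace_0)
  then have "x \<in> \<phi> ` N" by (intro image_eqI[of _ _ "(0, 0)"]) (auto simp: \<phi>_def)
  then obtain r where r: "r > 0" "ball x r \<inter> T \<subseteq> \<phi> ` N" using op by (auto simp: openin_contains_ball)
  define w where "w = v 2 - x"
  \<comment> \<open>A step from \<open>x\<close> towards \<open>v 2\<close>:
    \<open>u \<le> 1\<close> keeps the point on the segment inside \<open>C 2\<close>, and the added
    1 in the denominator makes the step strictly shorter than \<open>r\<close>.\<close>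
  define u where "u = min 1 (r / (norm w + 1))"
  have nw: "norm w + 1 > 0" by (simp add: add_nonneg_pos)
  have u: "0 < u" "u \<le> 1" using r(1) nw by (simp_all add: u_def)
  have "u * norm w < u * (norm w + 1)" using u by simp
  also have "\<dots> \<le> r / (norm w + 1) * (norm w + 1)"
    using nw by (intro mult_right_mono) (simp_all add: u_def)
  also have "\<dots> = r" using nw by simp
  finally have "x + u *\<^sub>R w \<in> ball x r" using u by (simp add: dist_norm)
  moreover have "(1 - u) *\<^sub>R x + u *\<^sub>R v 2 \<in> C 2"
    using C[of 2] v[of 2] u xF by (intro convexD) auto
  then have in2: "x + u *\<^sub>R w \<in> C 2" by (simp add: w_def algebra_simps)
  moreover have "x + u *\<^sub>R w \<in> T" using in2 C[of 2] by (simp add: subset_iff)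
  ultimately have "x + u *\<^sub>R w \<in> \<phi> ` N" by (intro subsetD[OF r(2)] IntI)
  then have "x + u *\<^sub>R w \<in> C 0 \<union> C 1" by (rule subsetD[OF sub])
  moreover have "C 0 \<inter> C 2 = F" "C 1 \<inter> C 2 = F" using CF[of 0 2] CF[of 1 2] by simp_all
  ultimately have "x + u *\<^sub>R w \<in> F" using in2 by blast
  then have "0 + u *\<^sub>R w \<in> S" using memS[of "u *\<^sub>R w"] hull_subset[of F affine] by auto
  then show False using out[of 0 u w] subspace_0[OF S] u(1) v[of 2] by (simp add: w_def)
qed

lemma charts_imp_pseudomanifold:
  assumes K: "dimensional_complex D K" and T: "euclidean_charts D (\<Union>K)"
  shows "pseudomanifold_complex D K"
proof -
  have sc: "simplicial_complex K" using K by (simp add: dimensional_complex_def)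
  have "card {\<delta>\<in>simplices (int D) K. F \<subseteq> \<delta>} = 2" if D: "D \<ge> 1" and F: "F \<in> simplices (int D - 1) K" for F
  proof -
    define S where "S = {\<delta>\<in>simplices (int D) K. F \<subseteq> \<delta>}"
    have Fs: "F \<in> K" "int D - 1 simplex F" using F by (auto simp: simplices_def)
    have "F \<noteq> {}" using Fs D by auto
    then obtain x where x: "x \<in> rel_interior F" using simplex_rel_interior_nonempty Fs by metis
    obtain N where N: "openin (top_of_set (\<Union>K)) N" "x \<in> N" "N \<subseteq> \<Union>{\<tau> \<in> K. F \<subseteq> \<tau>}"
      using open_star[OF sc Fs(1) x] by metis
    have NS: "N \<subseteq> \<Union>S"
    proof
      fix y assume "y \<in> N"
      then obtain \<tau> where t: "\<tau> \<in> K" "F \<subseteq> \<tau>" "y \<in> \<tau>" using N(3) by blast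
      then obtain \<delta> where "\<delta> \<in> simplices (int D) K" "\<tau> \<subseteq> \<delta>" using charts_imp_pure[OF K T t(1)] by blast
      then show "y \<in> \<Union>S" using t unfolding S_def by blast
    qed
    obtain \<delta> where d: "\<delta> \<in> S" using charts_imp_pure[OF K T Fs(1)] unfolding S_def by blast
    have Ss: "\<epsilon> \<in> K" "int D simplex \<epsilon>" "F \<subseteq> \<epsilon>" if "\<epsilon> \<in> S" for \<epsilon>
      using that by (auto simp: S_def simplices_def)
    have int: "\<epsilon> \<inter> \<epsilon>' = F" if "\<epsilon> \<in> S" "\<epsilon>' \<in> S" "\<epsilon> \<noteq> \<epsilon>'" for \<epsilon> \<epsilon>'
      using simplices_sharing_ridge_Int[OF sc F] that unfolding S_def by blast
    \<comment> \<open>If \<open>\<delta>\<close> were alone, \<open>N\<close> would be open in its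
      affine hull, making \<open>x\<close> a relative interior point of \<open>\<delta>\<close>
      although it lies in the proper face \<open>F\<close>.\<close>
    have "S \<noteq> {\<delta>}"
    proof
      assume "S = {\<delta>}"
      then have Nd: "N \<subseteq> \<delta>" using NS by simp
      then have "N \<subseteq> affine hull \<delta>" using hull_subset[of \<delta> affine] by blast
      then have "openin (top_of_set (affine hull \<delta>)) N"
        using charts_open_in_affine(2)[OF T affine_affine_hull _ N(1)] aff_dim_simplex[OF Ss(2)[OF d]] by simp
      then have "x \<in> rel_interior \<delta>" using rel_interior_maximal[OF Nd] N(2) by blast
      moreover have "F face_of \<delta>" using simplicial_complex_face[OF sc Fs(1)] Ss[OF d] by blast
      moreover have "F \<noteq> \<delta>" using aff_dim_simplex[OF Fs(2)] aff_dim_simplex[OF Ss(2)[OF d]] by auto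
      ultimately show False
        using face_of_disjoint_rel_interior x rel_interior_subset by blast
    qed
    then obtain \<epsilon> where e: "\<epsilon> \<in> S" "\<epsilon> \<noteq> \<delta>" using d by blast
    have "\<upsilon> = \<delta> \<or> \<upsilon> = \<epsilon>" if u: "\<upsilon> \<in> S" for \<upsilon>
    proof (rule ccontr)
      assume ne: "\<not> (\<upsilon> = \<delta> \<or> \<upsilon> = \<epsilon>)"
      define C where "C i = (if i = 0 then \<delta> else if i = 1 then \<epsilon> else \<upsilon>)" for i :: nat
      have CS: "C i \<in> S" for i using d e u by (simp add: C_def)
      have "convex (C i) \<and> F \<subseteq> C i \<and> C i \<subseteq> \<Union>K \<and> aff_dim (C i) = int D" for i
        using Ss[OF CS] convex_simplex aff_dim_simplex by blast
      moreover have "C i \<inter> C j = F" if "i < 3" "j < 3" "i \<noteq> j" for i j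
      proof (rule int[OF CS CS])
        show "C i \<noteq> C j" using that ne e by (auto simp: C_def numeral_3_eq_3 less_Suc_eq)
      qed
      ultimately show False using charts_at_most_two[OF T D Fs(2) x, of C] by blast
    qed
    then have "S = {\<delta>, \<epsilon>}" using d e by blast
    then show ?thesis using e(2) by (simp add: S_def[symmetric])
  qed
  then show ?thesis
    using sc K charts_imp_pure[OF K T] unfolding pseudomanifold_complex_def dimensional_complex_def by blast
qed

theorem proposition2:
  fixes X :: "'a::euclidean_space set set" and M :: "'b topology" and D :: nat
  assumes "closed_manifold D M"
    and "triangulates D X M"
  shows "complex_vertices (barycentric_subdivision D X)
           = {barycenter \<sigma> | \<sigma> i. i \<le> D \<and> \<sigma> \<in> simplices (int i) X} \<and>
         (\<exists>c. (\<forall>i\<le>D. \<forall>\<sigma>\<in>simplices (int i) X. c (barycenter \<sigma>) = i) \<and>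
              colex D (barycentric_subdivision D X)
                {(barycenter \<delta>, sd_boundary D \<delta>) | \<delta>. \<delta> \<in> simplices (int D) X} c)"
proof (rule pseudomanifold_subdivision_colex, rule charts_imp_pseudomanifold)
  show K: "dimensional_complex D X" using assms(2) by (simp add: triangulates_def)
  \<comment> \<open>The affine hull of a \<open>D\<close>-simplex of \<open>X\<close> serves as the
    common \<open>D\<close>-dimensional target of all charts.\<close>
  then obtain \<delta> where "\<delta> \<in> simplices (int D) X" unfolding dimensional_complex_def by blast
  then have "int D simplex \<delta>" by (simp add: simplices_def)
  then have "aff_dim (affine hull \<delta>) = int D" using aff_dim_simplex by (simp add: aff_dim_affine_hull)
  then show "euclidean_charts D (\<Union>X)"
    using locally_Euclidean_charts[OF _ _ affine_affine_hull] assms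
    by (auto simp: triangulates_def closed_manifold_def)
qed

end
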